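(* Every uncountable compact abelian topological group and every nondiscrete separable locally compact abelian topological group is nice; that is, it can be covered by $\mathrm{cof}(\mathcal{N})$ many translates of a compact set of Haar measure zero.
   Context: All topological groups are assumed to be Hausdorff. $\mathcal{N}$ denotes the family of Lebesgue null subsets of the real line $\mathbb{R}$, and $\mathrm{cof}(\mathcal{N})=\min\{|\mathcal{H}| : \mathcal{H}\subset\mathcal{N},\ \forall N\in\mathcal{N}\ \exists H\in\mathcal{H}\ N\subset H\}$. A locally compact group $G$ is called nice if there exists a compact set $C\subset G$ of Haar measure zero such that $G$ can be covered by $\mathrm{cof}(\mathcal{N})$ many left translates of $C$, i.e. $G=\bigcup_{a\in A} aC$ for some $A\subset G$ with $|A|\le\mathrm{cof}(\mathcal{N})$. *)

theory Defs
  imports "HOL-Analysis.Analysis" "HOL-Algebra.Coset"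
begin

unbundle cardinal_syntax

text \<open>All topological groups are Hausdorff by convention.\<close>

locale topological_group = group G for G (structure) +
  fixes T :: "'a topology"
  assumes topspace_eq: "topspace T = carrier G"
    and continuous_mult: "continuous_map (prod_topology T T) T (\<lambda>(x, y). x \<otimes> y)"
    and continuous_inv: "continuous_map T T (\<lambda>x. inv x)"
    and Hausdorff: "Hausdorff_space T"

locale locally_compact_group = topological_group +
  assumes locally_compact: "locally_compact_space T"

text \<open>
  A left Haar measure: a nonzero left-invariant Radon measure on the Borel sets of the group.
\<close>

definition left_haar_measure ::
    "('a, 'b) monoid_scheme \<Rightarrow> 'a topology \<Rightarrow> 'a measure \<Rightarrow> bool" where
  "left_haar_measure G T \<mu> \<longleftrightarrow>
     space \<mu> = topspace T \<and>
     sets \<mu> = sigma_sets (topspace T) {U. openin T U} \<and>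
     emeasure \<mu> (space \<mu>) \<noteq> 0 \<and>
     (\<forall>g\<in>carrier G. \<forall>B\<in>sets \<mu>. emeasure \<mu> (g <#\<^bsub>G\<^esub> B) = emeasure \<mu> B) \<and>
     (\<forall>K. compactin T K \<longrightarrow> emeasure \<mu> K < \<infinity>) \<and>
     (\<forall>B\<in>sets \<mu>. emeasure \<mu> B = (INF U\<in>{U. openin T U \<and> B \<subseteq> U}. emeasure \<mu> U)) \<and>
     (\<forall>U. openin T U \<longrightarrow> emeasure \<mu> U = (SUP K\<in>{K. compactin T K \<and> K \<subseteq> U}. emeasure \<mu> K))"

text \<open>
  On a locally compact group a left Haar measure exists and is unique up to a positive real
  factor, so quantifying over all of them says the same as choosing one.  The definition is
  meant for Borel sets; it is applied to compact sets only, which are closed since the groups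
  are Hausdorff.
\<close>

definition haar_null ::
    "('a, 'b) monoid_scheme \<Rightarrow> 'a topology \<Rightarrow> 'a set \<Rightarrow> bool" where
  "haar_null G T C \<longleftrightarrow> (\<forall>\<mu>. left_haar_measure G T \<mu> \<longrightarrow> emeasure \<mu> C = 0)"

definition cofinal_null_family :: "real set set \<Rightarrow> bool" where
  "cofinal_null_family \<H> \<longleftrightarrow>
     \<H> \<subseteq> null_sets lebesgue \<and> (\<forall>N\<in>null_sets lebesgue. \<exists>H\<in>\<H>. N \<subseteq> H)"

text \<open>
  Cardinals are represented by cardinal orders, hence are determined only up to order
  isomorphism; the choice operator picks a representative of the minimum.
\<close>

definition cof_null :: "real set rel" where
  "cof_null =
     (SOME \<kappa>. \<kappa> \<in> card_of ` Collect cofinal_null_family \<and>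
           (\<forall>\<H>. cofinal_null_family \<H> \<longrightarrow> \<kappa> \<le>o |\<H>| ))"

lemma cof_null_is_minimum:
  shows "\<exists>\<H>. cofinal_null_family \<H> \<and> cof_null = |\<H>|"
    and "cofinal_null_family \<H> \<Longrightarrow> cof_null \<le>o |\<H>|"
proof -
  let ?R = "card_of ` Collect cofinal_null_family"
  have "cofinal_null_family (null_sets lebesgue)"
    by (auto simp: cofinal_null_family_def)
  then have "?R \<noteq> {}" by blast
  moreover have "\<forall>r\<in>?R. Card_order r"
    by (auto intro: card_of_Card_order)
  ultimately obtain r where "r \<in> ?R" "\<forall>r'\<in>?R. r \<le>o r'"
    using exists_minim_Card_order[of ?R] by blast
  then have "\<exists>\<kappa>. \<kappa> \<in> ?R \<and> (\<forall>\<H>. cofinal_null_family \<H> \<longrightarrow> \<kappa> \<le>o |\<H>| )"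
    by blast
  from someI_ex[OF this]
  have *: "cof_null \<in> ?R \<and> (\<forall>\<H>. cofinal_null_family \<H> \<longrightarrow> cof_null \<le>o |\<H>| )"
    unfolding cof_null_def .
  from * show "\<exists>\<H>. cofinal_null_family \<H> \<and> cof_null = |\<H>|" by blast
  from * show "cofinal_null_family \<H> \<Longrightarrow> cof_null \<le>o |\<H>|" by blast
qed

definition nice_group :: "('a, 'b) monoid_scheme \<Rightarrow> 'a topology \<Rightarrow> bool" where
  "nice_group G T \<longleftrightarrow> locally_compact_group G T \<and>
     (\<exists>C A. compactin T C \<and> haar_null G T C \<and>
            A \<subseteq> carrier G \<and> |A| \<le>o cof_null \<and>
            carrier G = (\<Union>a\<in>A. a <#\<^bsub>G\<^esub> C))"

end

theory Submission
  imports Defs "HOL-Library.Discrete_Functions"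
begin

text \<open>
  No structure theory is needed.  By Bartoszynski's characterization there are \<open>cof(N)\<close> slaloms \<open>S\<close>
  with \<open>|S\<^sub>n| \<le> n + 1\<close> that capture every function on \<open>\<nat>\<close>, so a compact set \<open>L\<close> is covered by
  \<open>cof(N)\<close> sets \<open>\<Inter>\<^sub>n S\<^sub>n V\<^sub>n\<close>, where \<open>S\<^sub>n \<subseteq> L\<close> has at most \<open>n + 1\<close> points and the neighbourhoods \<open>V\<^sub>n\<close> of
  the identity may be chosen as small as we please.  Since Haar measure has no atoms, for every small
  neighbourhood \<open>U\<close> there is an open set \<open>W\<^sub>n\<close> so evenly spread that its density in each translate of
  \<open>U\<close> is less than \<open>1/(n + 1)\<close>, while it takes up a proportion of at least \<open>1/(16(n + 1))\<close> of what is
  left of a compact set \<open>K\<close>.  The first property yields, for each slalom, successive corrections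
  converging to some \<open>a\<close> such that \<open>a S\<^sub>n V\<^sub>n\<close> misses \<open>W\<^sub>n\<close> for all \<open>n\<close>; the second one makes
  \<open>C = K - \<Union>\<^sub>n W\<^sub>n\<close> null, because the harmonic series diverges.
\<close>

(* Multiset's ASCII notation clashes with that of left cosets. *)
no_notation (ASCII) subset_mset (infix \<open><#\<close> 50)

section \<open>Evenly spread subsets\<close>

text \<open>The width of the slaloms has to be balanced. Each of \<open>h\<close> points forbids the
  corrections that carry it into \<open>W n\<close>, and a union bound leaves a permitted one as
  soon as the density of \<open>W n\<close> is below 1/h. What remains after all removals is null if
  the removed proportions, of order 1/h, have divergent sum. Bartoszynski's coding on the line gives
  width \<open>2 ^ n\<close>, where this sum converges; hence the width is slowed down to
  \<open>Suc n\<close>.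

  \<open>C\<close> must serve all slaloms at once. Therefore the sets \<open>W n\<close> and
  \<open>V n\<close> and the neighbourhoods bounding later corrections are fixed in advance, and
  only the corrections depend on the slalom. Commutativity makes this possible: replacing
  \<open>y\<close> by \<open>y \<otimes> u\<close> changes each product \<open>y \<otimes> s\<close>
  to \<open>y \<otimes> s \<otimes> u\<close>, so the products of different points \<open>s\<close>
  run through translates of one and the same small set.

  The spreading lemmas below serve twice: on the unit interval they give the nearly independent open
  sets behind the slaloms, in the group they give \<open>W n\<close>.\<close>

lemma exists_subset_intermediate_measure:
  fixes M :: "'a measure"
  assumes X: "X \<in> fmeasurable M" and t: "0 < t" "t \<le> 1"
    and small: "\<And>\<epsilon>. 0 < \<epsilon> \<Longrightarrow>
      \<exists>F. finite F \<and> F \<subseteq> fmeasurable M \<and> X \<subseteq> \<Union>F \<and> (\<forall>B\<in>F. measure M B < \<epsilon>)"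
  shows "\<exists>E\<in>sets M. E \<subseteq> X \<and> t / 2 * measure M X \<le> measure M E \<and> measure M E \<le> t * measure M X"
proof (cases "measure M X = 0")
  case True
  then show ?thesis by (intro bexI[of _ "{}"]) auto
next
  case False
  then have pos: "0 < measure M X"
    by (simp add: zero_less_measure_iff)
  then obtain F where F: "finite F" "F \<subseteq> fmeasurable M" "X \<subseteq> \<Union>F"
      and F_small: "\<And>B. B \<in> F \<Longrightarrow> measure M B < t / 2 * measure M X"
    using small[of "t / 2 * measure M X"] t by auto
  \<comment> \<open>A maximal subfamily whose union stays below the proportion \<open>t\<close>
    reaches \<open>t / 2\<close>: otherwise one more piece, of measure less than
    \<open>t / 2 * measure M X\<close>, could be added.\<close>
  define \<G> where "\<G> = {\<F>. \<F> \<subseteq> F \<and> measure M (X \<inter> \<Union>\<F>) \<le> t * measure M X}"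
  have "finite \<G>" using F(1) by (simp add: \<G>_def)
  moreover have "{} \<in> \<G>" using t by (simp add: \<G>_def)
  ultimately obtain \<F> where \<F>: "\<F> \<in> \<G>" and max: "\<And>\<F>'. \<F>' \<in> \<G> \<Longrightarrow> \<F> \<subseteq> \<F>' \<Longrightarrow> \<F>' = \<F>"
    using finite_has_maximal[of \<G>] by blast
  have sub: "\<F> \<subseteq> F" using \<F> by (simp add: \<G>_def)
  have meas: "X \<inter> \<Union>\<A> \<in> fmeasurable M" if "\<A> \<subseteq> F" for \<A>
  proof -
    have "\<Union>\<A> \<in> sets M"
      using that F finite_subset[OF that] by (intro sets.finite_Union) (auto dest: fmeasurableD)
    then show ?thesis using X by (auto intro: fmeasurable_Int_fmeasurable)
  qed
  have "t / 2 * measure M X \<le> measure M (X \<inter> \<Union>\<F>)"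
  proof (rule ccontr)
    assume neg: "\<not> ?thesis"
    have "\<F> = F"
    proof (rule ccontr)
      assume "\<F> \<noteq> F"
      then obtain B where B: "B \<in> F" "B \<notin> \<F>" using sub by blast
      have "X \<inter> \<Union>(insert B \<F>) \<subseteq> (X \<inter> \<Union>\<F>) \<union> B" by auto
      then have "measure M (X \<inter> \<Union>(insert B \<F>)) \<le> measure M ((X \<inter> \<Union>\<F>) \<union> B)"
        using meas[OF sub] B F(2) meas[of "insert B \<F>"] sub
        by (intro measure_mono_fmeasurable) (auto dest: fmeasurableD)
      also have "\<dots> \<le> measure M (X \<inter> \<Union>\<F>) + measure M B"
        using meas[OF sub] B F(2) by (intro measure_Un_le) (auto dest: fmeasurableD)
      also have "\<dots> \<le> t * measure M X" using neg F_small[OF B(1)] by simp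
      finally have "insert B \<F> \<in> \<G>" using B sub by (simp add: \<G>_def)
      from max[OF this] B show False by blast
    qed
    then have "X \<inter> \<Union>\<F> = X" using F by auto
    then show False using neg t pos by (simp add: field_simps)
  qed
  then show ?thesis using \<F> meas[OF sub] by (auto simp: \<G>_def dest!: fmeasurableD)
qed

text \<open>Induction on \<open>\<D>\<close>: split \<open>X\<close> along \<open>A\<close>, treat
  \<open>X \<inter> A\<close> and \<open>X - A\<close> separately and add. The bounds for
  \<open>A\<close> itself are the total bounds on the part inside \<open>A\<close>, which is why the
  statement carries total bounds. The factor 2 is lost only on the final pieces, so it does not grow
  with \<open>\<D>\<close>.\<close>

lemma exists_subset_spread_measure:
  fixes M :: "'a measure"
  assumes "finite \<D>" "\<D> \<subseteq> sets M" and X: "X \<in> fmeasurable M" and t: "0 < t" "t \<le> 1"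
    and small: "\<And>\<epsilon>. 0 < \<epsilon> \<Longrightarrow>
      \<exists>F. finite F \<and> F \<subseteq> fmeasurable M \<and> X \<subseteq> \<Union>F \<and> (\<forall>B\<in>F. measure M B < \<epsilon>)"
  shows "\<exists>E\<in>sets M. E \<subseteq> X \<and> t / 2 * measure M X \<le> measure M E \<and> measure M E \<le> t * measure M X \<and>
           (\<forall>D\<in>\<D>. t / 2 * measure M (X \<inter> D) \<le> measure M (E \<inter> D) \<and>
                  measure M (E \<inter> D) \<le> t * measure M (X \<inter> D))"
  using assms(1,2) X small
proof (induction \<D> arbitrary: X)
  case empty
  then show ?case using exists_subset_intermediate_measure[OF empty(2) t empty(3)] by auto
next
  case (insert A \<D>)
  have A: "A \<in> sets M" and \<D>: "\<D> \<subseteq> sets M" using insert.prems by auto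
  have X1: "X \<inter> A \<in> fmeasurable M" and X2: "X - A \<in> fmeasurable M"
    using insert.prems(2) A by (auto intro: fmeasurable_Int_fmeasurable fmeasurable_Diff)
  have small': "\<exists>F. finite F \<and> F \<subseteq> fmeasurable M \<and> Y \<subseteq> \<Union>F \<and> (\<forall>B\<in>F. measure M B < \<epsilon>)"
    if "Y \<subseteq> X" "0 < \<epsilon>" for Y \<epsilon>
    using insert.prems(3)[OF that(2)] that(1) by (meson subset_trans)
  obtain E1 where E1: "E1 \<in> sets M" "E1 \<subseteq> X \<inter> A"
      "t / 2 * measure M (X \<inter> A) \<le> measure M E1" "measure M E1 \<le> t * measure M (X \<inter> A)"
      "\<And>D. D \<in> \<D> \<Longrightarrow> t / 2 * measure M (X \<inter> A \<inter> D) \<le> measure M (E1 \<inter> D)"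
      "\<And>D. D \<in> \<D> \<Longrightarrow> measure M (E1 \<inter> D) \<le> t * measure M (X \<inter> A \<inter> D)"
    using insert.IH[OF \<D> X1 small'[OF Int_lower1]] by blast
  obtain E2 where E2: "E2 \<in> sets M" "E2 \<subseteq> X - A"
      "t / 2 * measure M (X - A) \<le> measure M E2" "measure M E2 \<le> t * measure M (X - A)"
      "\<And>D. D \<in> \<D> \<Longrightarrow> t / 2 * measure M ((X - A) \<inter> D) \<le> measure M (E2 \<inter> D)"
      "\<And>D. D \<in> \<D> \<Longrightarrow> measure M (E2 \<inter> D) \<le> t * measure M ((X - A) \<inter> D)"
    using insert.IH[OF \<D> X2 small'[OF Diff_subset]] by blast
  have E1f: "E1 \<in> fmeasurable M" using fmeasurableI2[OF X1] E1 by blast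
  have E2f: "E2 \<in> fmeasurable M" using fmeasurableI2[OF X2] E2 by blast
  have add: "measure M (Y \<union> Z) = measure M Y + measure M Z"
    if "Y \<in> fmeasurable M" "Z \<in> fmeasurable M" "Y \<subseteq> A" "Z \<inter> A = {}" for Y Z
  proof -
    have "Y \<inter> Z = {}" using that by blast
    then show ?thesis using that by (simp add: measure_Un3)
  qed
  have X_split: "measure M (X \<inter> D) = measure M (X \<inter> A \<inter> D) + measure M ((X - A) \<inter> D)"
    if "D \<in> sets M" for D
    using that X1 X2 by (subst add[symmetric]) (auto intro!: fmeasurable_Int_fmeasurable arg_cong[where f = "measure M"])
  have E_split: "measure M ((E1 \<union> E2) \<inter> D) = measure M (E1 \<inter> D) + measure M (E2 \<inter> D)"
    if "D \<in> sets M" for D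
    using that E1f E2f E1(2) E2(2)
    by (subst add[symmetric]) (auto intro!: fmeasurable_Int_fmeasurable arg_cong[where f = "measure M"])
  have XA: "measure M X = measure M (X \<inter> A) + measure M (X - A)"
    using X1 X2 by (subst add[symmetric]) (auto intro!: arg_cong[where f = "measure M"])
  have EA: "measure M (E1 \<union> E2) = measure M E1 + measure M E2"
    using E1f E2f E1(2) E2(2) by (intro add) auto
  have EAA: "(E1 \<union> E2) \<inter> A = E1" using E1(2) E2(2) by auto
  show ?case
  proof (intro bexI conjI ballI)
    show "E1 \<union> E2 \<in> sets M" using E1 E2 by auto
    show "E1 \<union> E2 \<subseteq> X" using E1 E2 by auto
    show "t / 2 * measure M X \<le> measure M (E1 \<union> E2)"
      using E1(3) E2(3) unfolding XA EA by (simp add: ring_distribs)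
    show "measure M (E1 \<union> E2) \<le> t * measure M X"
      using E1(4) E2(4) unfolding XA EA by (simp add: ring_distribs)
    fix D assume "D \<in> insert A \<D>"
    then have "D = A \<or> D \<in> \<D>" by blast
    then show "t / 2 * measure M (X \<inter> D) \<le> measure M ((E1 \<union> E2) \<inter> D)"
      using E1(3) E1(5)[of D] E2(5)[of D] \<D> X_split[of D] E_split[of D]
      by (auto simp: EAA ring_distribs)
    show "measure M ((E1 \<union> E2) \<inter> D) \<le> t * measure M (X \<inter> D)"
      using \<open>D = A \<or> D \<in> \<D>\<close> E1(4) E1(6)[of D] E2(6)[of D] \<D> X_split[of D] E_split[of D]
      by (auto simp: EAA ring_distribs)
  qed
qed

section \<open>Slaloms from cofinal families of null sets\<close>

lemma unit_interval_small_cover: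
  assumes "0 < \<epsilon>"
  shows "\<exists>F. finite F \<and> F \<subseteq> lmeasurable \<and> {0..1::real} \<subseteq> \<Union>F \<and> (\<forall>B\<in>F. measure lebesgue B < \<epsilon>)"
proof -
  obtain N :: nat where N: "1 / real (Suc N) < \<epsilon>"
    using assms nat_approx_posE by blast
  define J where "J k = {real k / real (Suc N) .. (real k + 1) / real (Suc N)}" for k
  have "measure lebesgue (J k) = 1 / real (Suc N)" for k
    by (simp add: J_def measure_completion divide_simps) 
  moreover have "J k \<in> lmeasurable" for k
    unfolding J_def by (rule lmeasurable_interval)
  moreover have "{0..1} \<subseteq> \<Union>(J ` {..Suc N})"
  proof
    fix x :: real
    assume x: "x \<in> {0..1}"
    define k where "k = nat \<lfloor>x * real (Suc N)\<rfloor>"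
    have "0 \<le> x * real (Suc N)" "x * real (Suc N) \<le> real (Suc N)"
      using x by (auto simp: mult_le_cancel_right1)
    then have "real k \<le> x * real (Suc N)" "x * real (Suc N) \<le> real k + 1" "k \<le> Suc N"
      unfolding k_def by linarith+
    then show "x \<in> \<Union>(J ` {..Suc N})"
      by (auto simp: J_def pos_le_divide_eq pos_divide_le_eq simp del: of_nat_Suc)
  qed
  ultimately show ?thesis
    using N by (intro exI[of _ "J ` {..Suc N}"]) auto
qed

text \<open>A substitute for independence. Each set takes a share of at least
  \<open>\<delta> i / 4\<close> of every remainder left by a subfamily of its predecessors; these
  remainders are finitely many, so the spreading lemma applies. Removing the members of a finite
  \<open>I\<close> in increasing order then multiplies the bounds.\<close>

lemma exists_spread_open_sequence:
  fixes \<delta> :: "nat \<Rightarrow> real"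
  assumes \<delta>: "\<And>i. 0 < \<delta> i" "\<And>i. \<delta> i \<le> 1"
  obtains G :: "nat \<Rightarrow> real set"
  where "\<And>i. open (G i)" "\<And>i. G i \<in> lmeasurable" "\<And>i. measure lebesgue (G i) \<le> \<delta> i"
    "\<And>I. finite I \<Longrightarrow> measure lebesgue ({0..1} - \<Union>(G ` I)) \<le> (\<Prod>i\<in>I. 1 - \<delta> i / 4)"
proof -
  define R where "R i G = {{0..1} - \<Union>(G ` I) | I. I \<subseteq> {..<i}}" for i :: nat and G :: "nat \<Rightarrow> real set"
  define P where "P G i U \<longleftrightarrow> open U \<and> U \<in> lmeasurable \<and> measure lebesgue U \<le> \<delta> i \<and>
      (\<forall>D\<in>R i G. \<delta> i / 4 * measure lebesgue D \<le> measure lebesgue (U \<inter> D))" for G i U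
  have "\<exists>G. \<forall>i. P G i (G i)"
  proof (rule dependent_wellorder_choice)
    fix r :: "real set" and f g :: "nat \<Rightarrow> real set" and i :: nat
    assume "\<And>j. j < i \<Longrightarrow> f j = g j"
    then have "\<Union>(f ` I) = \<Union>(g ` I)" if "I \<subseteq> {..<i}" for I
      using that by (intro arg_cong[where f = "\<Union>"] image_cong) auto
    then have "R i f = R i g" unfolding R_def by (metis (no_types, lifting))
    then show "P f i r \<longleftrightarrow> P g i r" by (simp add: P_def)
  next
    fix i and f :: "nat \<Rightarrow> real set"
    assume IH: "\<And>j. j < i \<Longrightarrow> P f j (f j)"
    have R: "R i f \<subseteq> Pow {0..1}" "R i f \<subseteq> sets lebesgue"
    proof -
      have "\<Union>(f ` I) \<in> sets lebesgue" if "I \<subseteq> {..<i}" for I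
      proof -
        have "open (\<Union>(f ` I))" using IH that by (intro open_UN) (auto simp: P_def)
        then show ?thesis by simp
      qed
      then show "R i f \<subseteq> sets lebesgue" by (auto simp: R_def)
    qed (auto simp: R_def)
    have "finite (R i f)" unfolding R_def by simp
    \<comment> \<open>Spreading is done at level \<open>\<delta> i / 2\<close>, with lower bound
      \<open>\<delta> i / 4\<close>; the other half of \<open>\<delta> i\<close> is spent on
      enlarging \<open>E\<close> to an open set.\<close>
    from exists_subset_spread_measure[OF this R(2) lmeasurable_interval(1)[of 0 1], of "\<delta> i / 2"]
    obtain E where E: "E \<in> sets lebesgue" "E \<subseteq> {0..1}" "measure lebesgue E \<le> \<delta> i / 2"
        "\<And>D. D \<in> R i f \<Longrightarrow> \<delta> i / 4 * measure lebesgue ({0..1} \<inter> D) \<le> measure lebesgue (E \<inter> D)"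
      using \<delta>[of i] unit_interval_small_cover by auto
    have Em: "E \<in> lmeasurable"
      using fmeasurableI2[OF lmeasurable_interval(1) E(2) E(1)] .
    obtain U where U: "open U" "E \<subseteq> U" "U - E \<in> lmeasurable" "emeasure lebesgue (U - E) < ennreal (\<delta> i / 2)"
      using sets_lebesgue_outer_open[OF E(1), of "\<delta> i / 2"] \<delta>[of i] by auto
    have Ueq: "U = E \<union> (U - E)" using U(2) by auto
    then have Um: "U \<in> lmeasurable" using Em U(3) by (metis fmeasurable.Un)
    have "measure lebesgue (U - E) \<le> \<delta> i / 2"
      using U(3,4) \<delta>[of i] by (simp add: emeasure_eq_measure2 ennreal_less_iff)
    then have "measure lebesgue U \<le> \<delta> i"
      using measure_Un_le[OF E(1) fmeasurableD[OF U(3)]] Ueq E(3) by simp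
    moreover have "\<delta> i / 4 * measure lebesgue D \<le> measure lebesgue (U \<inter> D)" if "D \<in> R i f" for D
    proof -
      have "{0..1} \<inter> D = D" using R that by auto
      then have "\<delta> i / 4 * measure lebesgue D \<le> measure lebesgue (E \<inter> D)"
        using E(4)[OF that] by simp
      also have "\<dots> \<le> measure lebesgue (U \<inter> D)"
        using U(2) E(1) Um R that
        by (intro measure_mono_fmeasurable) (auto intro: fmeasurable_Int_fmeasurable)
      finally show ?thesis .
    qed
    ultimately show "\<exists>r. P f i r" using U(1) Um by (auto simp: P_def)
  qed
  then obtain G where G: "\<And>i. P G i (G i)" by blast
  have "measure lebesgue ({0..1} - \<Union>(G ` I)) \<le> (\<Prod>i\<in>I. 1 - \<delta> i / 4)" if "finite I" for I
    using that
  proof (induction rule: finite_linorder_max_induct)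
    case empty
    show ?case by simp
  next
    case (insert i I)
    let ?D = "{0..1} - \<Union>(G ` I)"
    have "\<Union>(G ` I) \<in> sets lebesgue"
      using insert(1) G by (intro sets.finite_UN) (auto simp: P_def)
    then have D: "?D \<in> lmeasurable" by (intro fmeasurable_Diff lmeasurable_interval)
    have "?D \<in> R i G" using insert(2) by (auto simp: R_def)
    then have *: "\<delta> i / 4 * measure lebesgue ?D \<le> measure lebesgue (G i \<inter> ?D)"
      using G[of i] by (simp add: P_def)
    have "{0..1} - \<Union>(G ` insert i I) = ?D - G i \<inter> ?D" by auto
    also have "measure lebesgue \<dots> = measure lebesgue ?D - measure lebesgue (G i \<inter> ?D)"
      using D G[of i] by (intro measurable_measure_Diff) (auto simp: P_def intro!: sets.Int)
    also have "\<dots> \<le> (1 - \<delta> i / 4) * measure lebesgue ?D"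
      using * by (simp add: algebra_simps)
    also have "\<dots> \<le> (1 - \<delta> i / 4) * (\<Prod>i\<in>I. 1 - \<delta> i / 4)"
      using insert.IH \<delta>(2)[of i] by (intro mult_left_mono) auto
    also have "\<dots> = (\<Prod>i\<in>insert i I. 1 - \<delta> i / 4)"
      using insert(1,2) by (subst prod.insert) auto
    finally show ?case .
  qed
  moreover have "open (G i)" "G i \<in> lmeasurable" "measure lebesgue (G i) \<le> \<delta> i" for i
    using G[of i] unfolding P_def by blast+
  ultimately show thesis by (rule that[rotated 3])
qed

lemma compact_avoiding_null_set:
  assumes "H \<in> null_sets lebesgue"
  obtains K :: "real set" where "compact K" "K \<subseteq> {0..1}" "K \<inter> H = {}" "0 < measure lebesgue K"
proof -
  have "{0..1} - H \<in> sets lebesgue" using assms by auto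
  then obtain K where K: "closed K" "K \<subseteq> {0..1} - H" "({0..1} - H) - K \<in> lmeasurable"
      "emeasure lebesgue (({0..1} - H) - K) < ennreal 1"
    by (rule sets_lebesgue_inner_closed[OF _ zero_less_one])
  have "compact K"
    using K(1,2) bounded_subset[OF bounded_closed_interval[of 0 1], of K]
    by (auto simp: compact_eq_bounded_closed)
  moreover have "0 < measure lebesgue K"
  proof (rule ccontr)
    assume "\<not> ?thesis"
    then have "measure lebesgue K = 0" by (simp add: zero_less_measure_iff)
    moreover have "K \<in> lmeasurable" using \<open>compact K\<close> by (rule lmeasurable_compact)
    ultimately have "K \<in> null_sets lebesgue"
      by (simp add: null_sets_def emeasure_eq_measure2 fmeasurableD)
    then have N: "H \<union> K \<in> null_sets lebesgue" using assms by auto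
    have "emeasure lebesgue {0..1::real} = emeasure lebesgue ({0..1} - (H \<union> K))"
      using N by (subst emeasure_Diff_null_set) auto
    also have "{0..1} - (H \<union> K) = ({0..1} - H) - K" by blast
    also have "emeasure lebesgue \<dots> < 1" using K(4) by simp
    finally show False by simp
  qed
  ultimately show thesis using that[of K] K by auto
qed

text \<open>Otherwise \<open>A \<inter> U\<close> would be a countable union of null sets. Rational
  endpoints keep the number of possible portions countable, so that recording one does not enlarge
  the slalom family.\<close>

lemma open_positive_rat_interval:
  assumes "open U" "A \<in> lmeasurable" "0 < measure lebesgue (A \<inter> U)"
  shows "\<exists>p q. {of_rat p..of_rat q} \<subseteq> U \<and> 0 < measure lebesgue (A \<inter> {real_of_rat p..of_rat q})"
proof (rule ccontr)
  assume neg: "\<not> ?thesis"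
  define I where "I = {(p, q). {real_of_rat p..of_rat q} \<subseteq> U}"
  have "A \<inter> {real_of_rat p..of_rat q} \<in> null_sets lebesgue" if "(p, q) \<in> I" for p q
  proof -
    have "measure lebesgue (A \<inter> {real_of_rat p..of_rat q}) = 0"
      using neg that by (auto simp: I_def zero_less_measure_iff)
    moreover have "A \<inter> {real_of_rat p..of_rat q} \<in> lmeasurable"
      using assms(2) by (intro fmeasurable_Int_fmeasurable) auto
    ultimately show ?thesis by (auto simp: null_sets_def emeasure_eq_measure2 fmeasurableD)
  qed
  then have null: "(\<Union>(p, q)\<in>I. A \<inter> {real_of_rat p..of_rat q}) \<in> null_sets lebesgue"
    by (intro null_sets_UN') auto
  have "A \<inter> U \<subseteq> (\<Union>(p, q)\<in>I. A \<inter> {real_of_rat p..of_rat q})"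
  proof
    fix x assume x: "x \<in> A \<inter> U"
    then obtain e where e: "0 < e" "ball x e \<subseteq> U" using assms(1) open_contains_ball by blast
    obtain p where p: "x - e < of_rat p" "of_rat p < x" using of_rat_dense[of "x - e" x] e by auto
    obtain q where q: "x < of_rat q" "of_rat q < x + e" using of_rat_dense[of x "x + e"] e by auto
    have "{real_of_rat p..of_rat q} \<subseteq> ball x e" using p q by (auto simp: dist_real_def)
    then have "(p, q) \<in> I" using e by (auto simp: I_def)
    then show "x \<in> (\<Union>(p, q)\<in>I. A \<inter> {real_of_rat p..of_rat q})" using x p q by force
  qed
  moreover have "A \<inter> U \<in> sets lebesgue" using assms by auto
  ultimately have "A \<inter> U \<in> null_sets lebesgue" using null null_sets_subset by blast
  then show False using assms(3) by (simp add: measure_def null_sets_def)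
qed

text \<open>Avoiding \<open>2 ^ n\<close> nearly independent sets of level n costs a factor bounded
  away from 1 uniformly in n, so avoiding them at infinitely many levels leaves measure 0.\<close>

lemma power_two_le_exp:
  "(1 - (1 / 2 :: real) ^ n / 4) ^ (2 ^ n) \<le> exp (- 1 / 4)"
proof -
  have "(1 - (1 / 2 :: real) ^ n / 4) ^ (2 ^ n) \<le> exp (- ((1 / 2) ^ n / 4)) ^ (2 ^ n)"
    using exp_ge_add_one_self[of "- ((1 / 2) ^ n / 4) :: real"] power_le_one[of "1/2::real" n]
    by (intro power_mono) auto
  also have "\<dots> = exp (real (2 ^ n) * (- ((1 / 2) ^ n / 4)))"
    by (rule exp_of_nat_mult[symmetric])
  also have "real (2 ^ n) * (- ((1 / 2) ^ n / 4)) = - 1 / 4"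
    by (simp add: power_one_over field_simps)
  finally show ?thesis .
qed

text \<open>Infinity lets countable factors be absorbed into \<open>|\<H>|\<close>. A finite family
  would have a null union, and a singleton outside it would be covered by no member.\<close>

lemma cofinal_null_family_infinite:
  assumes "cofinal_null_family \<H>"
  shows "infinite \<H>"
proof
  assume "finite \<H>"
  then have "\<Union>\<H> \<in> null_sets lebesgue"
    using assms null_sets.finite_Union[of \<H> lebesgue] by (auto simp: cofinal_null_family_def)
  then have "\<Union>\<H> \<noteq> UNIV" by (auto simp: null_sets_def)
  then obtain x where x: "x \<notin> \<Union>\<H>" by auto
  have "{x} \<in> null_sets lebesgue" by auto
  then obtain H where "H \<in> \<H>" "{x} \<subseteq> H"
    using assms unfolding cofinal_null_family_def by blast
  with x show False by blast
qed

text \<open>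
  Bartoszynski's argument: code \<open>f\<close> by the null set \<open>limsup G\<^sub>n\<^sub>,\<^sub>f\<^sub>(\<^sub>n\<^sub>)\<close>.  A compact set missing
  this null set has, by Baire category, a nonnull portion that misses \<open>G\<^sub>n\<^sub>,\<^sub>f\<^sub>(\<^sub>n\<^sub>)\<close> for all large
  \<open>n\<close>, and a nonnull set can miss only few of the nearly independent \<open>G\<^sub>n\<^sub>,\<^sub>m\<close>.
\<close>

lemma slalom_family_power_two:
  assumes \<H>: "cofinal_null_family \<H>"
  obtains \<S> :: "(nat \<Rightarrow> nat set) set"
  where "|\<S>| \<le>o |\<H>|" "\<And>S n. S \<in> \<S> \<Longrightarrow> finite (S n) \<and> card (S n) \<le> 2 ^ n"
    "\<And>f. \<exists>S\<in>\<S>. \<forall>n. f n \<in> S n"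
proof -
  \<comment> \<open>The index \<open>i\<close> codes a pair (n, m). The size depends on n only, so
    that the sizes along any \<open>f\<close> have a finite sum and Borel-Cantelli applies.\<close>
  define \<delta> :: "nat \<Rightarrow> real" where "\<delta> i = (1 / 2) ^ fst (prod_decode i)" for i
  have "0 < \<delta> i" "\<delta> i \<le> 1" for i by (auto simp: \<delta>_def power_le_one)
  then obtain G' :: "nat \<Rightarrow> real set" where G': "\<And>i. open (G' i)" "\<And>i. G' i \<in> lmeasurable"
      "\<And>i. measure lebesgue (G' i) \<le> \<delta> i"
      "\<And>I. finite I \<Longrightarrow> measure lebesgue ({0..1} - \<Union>(G' ` I)) \<le> (\<Prod>i\<in>I. 1 - \<delta> i / 4)"
    using exists_spread_open_sequence by metis
  define G where "G n m = G' (prod_encode (n, m))" for n m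
  have "\<forall>H\<in>\<H>. \<exists>K. compact K \<and> K \<subseteq> {0..1} \<and> K \<inter> H = {} \<and> 0 < measure lebesgue K"
    using \<H> compact_avoiding_null_set unfolding cofinal_null_family_def by (metis subsetD)
  then obtain K where K: "\<And>H. H \<in> \<H> \<Longrightarrow> compact (K H)" "\<And>H. H \<in> \<H> \<Longrightarrow> K H \<subseteq> {0..1}"
      "\<And>H. H \<in> \<H> \<Longrightarrow> K H \<inter> H = {}" "\<And>H. H \<in> \<H> \<Longrightarrow> 0 < measure lebesgue (K H)"
    by metis
  define J where "J r = {real_of_rat (fst r)..of_rat (snd r)}" for r
  define Q where "Q H r = K H \<inter> J r" for H r
  \<comment> \<open>Missing is meant up to null sets: if \<open>f n\<close> lies outside, the
    intersection has positive measure, which lets the nested portions below keep positive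
    measure.\<close>
  define S0 where "S0 H r n = {m. measure lebesgue (Q H r \<inter> G n m) = 0}" for H r n
  define good where "good H r n \<longleftrightarrow> finite (S0 H r n) \<and> card (S0 H r n) \<le> 2 ^ n" for H r n
  \<comment> \<open>The word \<open>w\<close> prescribes the finitely many initial values, where the
    portion need not miss the coded set or the width bound may fail; the default \<open>{}\<close>
    only protects the width bound.\<close>
  define S where "S = (\<lambda>(H, r, w) n. if n < length w then {w ! n} else if good H r n then S0 H r n else {})"
  have Qc: "compact (Q H r)" if "H \<in> \<H>" for H r
    using K(1)[OF that] by (auto simp: Q_def J_def intro: compact_Int_closed)
  have Qm: "Q H r \<in> lmeasurable" if "H \<in> \<H>" for H r
    using Qc[OF that] by (rule lmeasurable_compact)

  \<comment> \<open>Each bad n supplies \<open>2 ^ n\<close> members of \<open>S0 H r n\<close>,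
    hence a factor \<open>exp (- 1 / 4)\<close> in the bound for the measure of the portion;
    infinitely many bad n contradict its positivity.\<close>
  have few: "\<exists>n0. \<forall>n\<ge>n0. good H r n" if H: "H \<in> \<H>" and pos: "0 < measure lebesgue (Q H r)" for H r
  proof (rule ccontr)
    assume "\<not> ?thesis"
    then have "infinite {n. \<not> good H r n}" unfolding infinite_nat_iff_unbounded_le by auto
    have "\<exists>I. I \<subseteq> S0 H r n \<and> finite I \<and> card I = 2 ^ n" if "\<not> good H r n" for n
    proof (cases "finite (S0 H r n)")
      case True
      then have "2 ^ n \<le> card (S0 H r n)" using that by (simp add: good_def)
      then show ?thesis using obtain_subset_with_card_n by metis
    next
      case False
      then show ?thesis using infinite_arbitrarily_large by metis
    qed
    then obtain I where I: "\<And>n. \<not> good H r n \<Longrightarrow> I n \<subseteq> S0 H r n"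
        "\<And>n. \<not> good H r n \<Longrightarrow> finite (I n)" "\<And>n. \<not> good H r n \<Longrightarrow> card (I n) = 2 ^ n"
      by metis
    have bound: "measure lebesgue (Q H r) \<le> exp (- 1 / 4) ^ N" for N
    proof -
      obtain B where B: "finite B" "card B = N" "B \<subseteq> {n. \<not> good H r n}"
        using infinite_arbitrarily_large[OF \<open>infinite {n. \<not> good H r n}\<close>] by blast
      define P where "P = prod_encode ` (SIGMA n:B. I n)"
      have fin: "finite (SIGMA n:B. I n)" using B I by (intro finite_SigmaI) auto
      then have "finite P" by (simp add: P_def)
      have "Q H r \<inter> G' i \<in> null_sets lebesgue" if "i \<in> P" for i
      proof -
        have "measure lebesgue (Q H r \<inter> G' i) = 0"
          using that B I(1) by (fastforce simp: P_def S0_def G_def)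
        moreover have "Q H r \<inter> G' i \<in> lmeasurable"
          using Qm[OF H] G'(2) by (intro fmeasurable_Int_fmeasurable) auto
        ultimately show ?thesis by (auto simp: null_sets_def emeasure_eq_measure2 fmeasurableD)
      qed
      then have null: "(\<Union>i\<in>P. Q H r \<inter> G' i) \<in> null_sets lebesgue"
        using \<open>finite P\<close> by (intro null_sets.finite_UN) auto
      have Um: "\<Union>(G' ` P) \<in> sets lebesgue" using \<open>finite P\<close> G'(2) by (intro sets.finite_UN) auto
      have "measure lebesgue (Q H r) = measure lebesgue (Q H r - (\<Union>i\<in>P. Q H r \<inter> G' i))"
        using Qm[OF H] null by (metis measure_Diff_null_set fmeasurableD)
      also have "Q H r - (\<Union>i\<in>P. Q H r \<inter> G' i) = Q H r - \<Union>(G' ` P)" by auto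
      also have "measure lebesgue \<dots> \<le> measure lebesgue ({0..1} - \<Union>(G' ` P))"
        using K(2)[OF H] Qm[OF H] Um
        by (intro measure_mono_fmeasurable fmeasurable_Diff) (auto simp: Q_def dest: fmeasurableD)
      also have "\<dots> \<le> (\<Prod>i\<in>P. 1 - \<delta> i / 4)" using G'(4)[OF \<open>finite P\<close>] .
      also have "\<dots> = (\<Prod>x\<in>(SIGMA n:B. I n). 1 - (1 / 2) ^ fst x / 4)"
        unfolding P_def by (subst prod.reindex) (auto simp: \<delta>_def inj_prod_encode)
      also have "\<dots> = (\<Prod>n\<in>B. \<Prod>m\<in>I n. 1 - (1 / 2) ^ n / 4)"
        using B I by (subst prod.Sigma) (auto simp: case_prod_unfold)
      also have "\<dots> = (\<Prod>n\<in>B. (1 - (1 / 2) ^ n / 4) ^ (2 ^ n))"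
        using B I by (intro prod.cong) auto
      also have "\<dots> \<le> (\<Prod>n\<in>B. exp (- 1 / 4))"
      proof (intro prod_mono conjI zero_le_power)
        show "0 \<le> 1 - (1 / 2 :: real) ^ n / 4" for n
          using power_le_one[of "1/2::real" n] by simp
      qed (rule power_two_le_exp)
      finally show ?thesis using B by simp
    qed
    have "(\<lambda>N. exp (- 1 / 4 :: real) ^ N) \<longlonglongrightarrow> 0" by (intro LIMSEQ_power_zero) auto
    from LIMSEQ_le_const[OF this, of "measure lebesgue (Q H r)"] bound pos show False by auto
  qed

  have portion: "\<exists>r k. 0 < measure lebesgue (Q H r) \<and> (\<forall>n\<ge>k. f n \<in> S0 H r n)"
    if H: "H \<in> \<H>" and lim: "limsup (\<lambda>n. G n (f n)) \<subseteq> H" for H f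
  proof (rule ccontr)
    assume "\<not> ?thesis"
    then have neg: "\<not> (0 < measure lebesgue (Q H r) \<and> (\<forall>n\<ge>k. f n \<in> S0 H r n))" for r k by blast
    have neg: "\<exists>n\<ge>k. 0 < measure lebesgue (Q H r \<inter> G n (f n))" if pos: "0 < measure lebesgue (Q H r)" for r k
    proof -
      obtain n where "n \<ge> k" "f n \<notin> S0 H r n" using neg pos by blast
      then show ?thesis by (auto simp: S0_def zero_less_measure_iff)
    qed
    \<comment> \<open>The Baire step: the new interval lies in the old one and in some
      \<open>G n (f n)\<close> with n as large as desired. A point common to all the compact
      portions belongs to the limsup and hence to \<open>H\<close>, which \<open>K H\<close>
      misses.\<close>
    have step: "\<exists>r'. 0 < measure lebesgue (Q H r') \<and> (J r' \<subseteq> J r \<and> (\<exists>n\<ge>k. J r' \<subseteq> G n (f n)))"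
      if pos: "0 < measure lebesgue (Q H r)" for r k
    proof -
      obtain n where n: "n \<ge> k" "0 < measure lebesgue (Q H r \<inter> G n (f n))" using neg[OF pos] by blast
      have "open (G n (f n))" by (simp add: G_def G')
      from open_positive_rat_interval[OF this Qm[OF H] n(2)]
      obtain p q where pq: "{of_rat p..of_rat q} \<subseteq> G n (f n)"
          "0 < measure lebesgue (Q H r \<inter> {real_of_rat p..of_rat q})" by blast
      define r' where "r' = (max (fst r) p, min (snd r) q)"
      have "J r' = J r \<inter> {of_rat p..of_rat q}"
      proof -
        have "real_of_rat (max a b) = max (of_rat a) (of_rat b)"
             "real_of_rat (min a b) = min (of_rat a) (of_rat b)" for a b
          by (simp_all add: max_def min_def of_rat_less_eq)
        then show ?thesis by (auto simp: J_def r'_def)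
      qed
      then have "Q H r' = Q H r \<inter> {of_rat p..of_rat q}" "J r' \<subseteq> J r" "J r' \<subseteq> G n (f n)"
        using pq by (auto simp: Q_def)
      then show ?thesis using pq n by metis
    qed
    have "0 < measure lebesgue (Q H (0, 1))"
    proof -
      have "Q H (0, 1) = K H" using K(2)[OF H] by (auto simp: Q_def J_def)
      then show ?thesis using K(4)[OF H] by simp
    qed
    then have "\<exists>r. \<forall>k. 0 < measure lebesgue (Q H (r k)) \<and>
        (J (r (Suc k)) \<subseteq> J (r k) \<and> (\<exists>n\<ge>k. J (r (Suc k)) \<subseteq> G n (f n)))"
      using step by (intro dependent_nat_choice) blast+
    then obtain r where r: "\<And>k. 0 < measure lebesgue (Q H (r k))" "\<And>k. J (r (Suc k)) \<subseteq> J (r k)"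
        "\<And>k. \<exists>n\<ge>k. J (r (Suc k)) \<subseteq> G n (f n)" by blast
    have dec: "J (r n) \<subseteq> J (r m)" if "m \<le> n" for m n
      using lift_Suc_antimono_le[of "\<lambda>k. J (r k)", OF r(2) that] .
    have "Q H (r k) \<noteq> {}" for k using r(1)[of k] by auto
    then have "(\<Inter>k. Q H (r k)) \<noteq> {}"
    proof (intro compact_nest)
      show "Q H (r n) \<subseteq> Q H (r m)" if "m \<le> n" for m n
        using dec[OF that] by (auto simp: Q_def)
    qed (use Qc[OF H] in auto)
    then obtain x where x: "\<And>k. x \<in> Q H (r k)" by blast
    have "\<exists>n\<ge>k. x \<in> G n (f n)" for k using r(3)[of k] x[of "Suc k"] by (auto simp: Q_def)
    then have "x \<in> limsup (\<lambda>n. G n (f n))" by (auto simp: limsup_INF_SUP)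
    then show False using lim x K(3)[OF H] by (auto simp: Q_def)
  qed

  show thesis
  proof (rule that[of "S ` (\<H> \<times> UNIV)"])
    have "|S ` (\<H> \<times> UNIV)| \<le>o |\<H> \<times> (UNIV :: ((rat \<times> rat) \<times> nat list) set)|" by (rule card_of_image)
    also have "|\<H> \<times> (UNIV :: ((rat \<times> rat) \<times> nat list) set)| \<le>o |\<H>|"
    proof -
      have countable: "|UNIV :: ((rat \<times> rat) \<times> nat list) set| \<le>o |\<H>|"
      proof (rule ordLeq_transitive)
        show "|UNIV :: ((rat \<times> rat) \<times> nat list) set| \<le>o |UNIV :: nat set|"
          by (intro card_of_ordLeq[THEN iffD1] exI[of _ to_nat]) auto
        show "|UNIV :: nat set| \<le>o |\<H>|"
          using cofinal_null_family_infinite[OF \<H>] infinite_iff_card_of_nat by blast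
      qed
      show ?thesis
        by (rule ordIso_imp_ordLeq[OF card_of_Times_infinite_simps(1)[OF
              cofinal_null_family_infinite[OF \<H>] UNIV_not_empty countable]])
    qed
    finally show "|S ` (\<H> \<times> UNIV)| \<le>o |\<H>|" .
    show "finite (s n) \<and> card (s n) \<le> 2 ^ n" if "s \<in> S ` (\<H> \<times> UNIV)" for s n
      using that by (auto simp: S_def good_def)
    show "\<exists>s\<in>S ` (\<H> \<times> UNIV). \<forall>n. f n \<in> s n" for f
    proof -
      have "limsup (\<lambda>n. G n (f n)) \<in> null_sets lebesgue"
      proof (rule borel_cantelli_limsup1)
        show "G n (f n) \<in> sets lebesgue" "emeasure lebesgue (G n (f n)) < \<infinity>" for n
          using G'(2) unfolding G_def fmeasurable_def infinity_ennreal_def by blast+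
        show "summable (\<lambda>n. measure lebesgue (G n (f n)))"
        proof (rule summable_comparison_test'[where g = "\<lambda>n. (1 / 2) ^ n"])
          show "norm (measure lebesgue (G n (f n))) \<le> (1 / 2) ^ n" for n
            using G'(3)[of "prod_encode (n, f n)"] by (simp add: G_def \<delta>_def)
        qed simp
      qed
      then obtain H where H: "H \<in> \<H>" "limsup (\<lambda>n. G n (f n)) \<subseteq> H"
        using \<H> by (auto simp: cofinal_null_family_def)
      obtain r k where r: "0 < measure lebesgue (Q H r)" "\<And>n. n \<ge> k \<Longrightarrow> f n \<in> S0 H r n"
        using portion[OF H] by blast
      obtain n0 where n0: "\<And>n. n \<ge> n0 \<Longrightarrow> good H r n" using few[OF H(1) r(1)] by blast
      define w where "w = map f [0..<max k n0]"
      have "f n \<in> S (H, r, w) n" for n using r n0 by (auto simp: S_def w_def)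
      then show ?thesis using H by (intro bexI[of _ "S (H, r, w)"]) auto
    qed
  qed
qed

text \<open>Coding initial segments of \<open>f\<close> of length \<open>2 \<cdot> 2\<^sup>k\<close> by single numbers slows the growth down.\<close>

lemma slalom_family:
  assumes \<H>: "cofinal_null_family \<H>"
  obtains \<S> :: "(nat \<Rightarrow> nat set) set"
  where "|\<S>| \<le>o |\<H>|" "\<And>S n. S \<in> \<S> \<Longrightarrow> finite (S n) \<and> card (S n) \<le> Suc n"
    "\<And>f. \<exists>S\<in>\<S>. \<forall>n. f n \<in> S n"
proof -
  obtain \<S> :: "(nat \<Rightarrow> nat set) set" where \<S>: "|\<S>| \<le>o |\<H>|" "\<And>S n. S \<in> \<S> \<Longrightarrow> finite (S n) \<and> card (S n) \<le> 2 ^ n"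
    "\<And>f. \<exists>S\<in>\<S>. \<forall>n. f n \<in> S n"
    using slalom_family_power_two[OF \<H>] by blast
  \<comment> \<open>For k = \<open>floor_log (Suc n)\<close>, \<open>Suc n\<close> is at least
    \<open>2 ^ k\<close>, which bounds the width, and below \<open>2 * 2 ^ k\<close>, so position n
    exists in the coded segment.\<close>
  define \<phi> where "\<phi> S n = (\<lambda>c. list_decode c ! n) ` S (floor_log (Suc n))" for S :: "nat \<Rightarrow> nat set" and n
  have le: "2 ^ floor_log (Suc n) \<le> Suc n" for n by (rule floor_log_exp2_le) simp
  show thesis
  proof (rule that[of "\<phi> ` \<S>"])
    show "|\<phi> ` \<S>| \<le>o |\<H>|" using card_of_image \<S>(1) ordLeq_transitive by blast
    show "finite (S n) \<and> card (S n) \<le> Suc n" if S: "S \<in> \<phi> ` \<S>" for S n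
    proof -
      obtain S' where S': "S' \<in> \<S>" "S = \<phi> S'" using S by blast
      then show ?thesis
        using \<S>(2)[OF S'(1), of "floor_log (Suc n)"] le[of n]
          card_image_le[of "S' (floor_log (Suc n))" "\<lambda>c. list_decode c ! n"]
        by (auto simp: \<phi>_def)
    qed
    show "\<exists>S\<in>\<phi> ` \<S>. \<forall>n. f n \<in> S n" for f
    proof -
      obtain S where S: "S \<in> \<S>" "\<And>k. list_encode (map f [0..<2 * 2 ^ k]) \<in> S k"
        using \<S>(3)[of "\<lambda>k. list_encode (map f [0..<2 * 2 ^ k])"] by blast
      have "f n \<in> \<phi> S n" for n
      proof -
        have "n < 2 * 2 ^ floor_log (Suc n)" using floor_log_exp2_gt[of "Suc n"] by simp
        then have "f n = list_decode (list_encode (map f [0..<2 * 2 ^ floor_log (Suc n)])) ! n"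
          by simp
        then show ?thesis using S(2) unfolding \<phi>_def by (rule image_eqI)
      qed
      then show ?thesis using S(1) by (intro bexI[of _ "\<phi> S"]) auto
    qed
  qed
qed

section \<open>Topological groups\<close>

context topological_group
begin

lemma openin_subset_carrier: "openin T U \<Longrightarrow> U \<subseteq> carrier G"
  using openin_subset topspace_eq by blast

lemma compactin_subset_carrier: "compactin T K \<Longrightarrow> K \<subseteq> carrier G"
  using compactin_subset_topspace topspace_eq by blast

lemma continuous_l_mult:
  assumes "g \<in> carrier G"
  shows "continuous_map T T (\<lambda>x. g \<otimes> x)"
proof -
  have "continuous_map T (prod_topology T T) (\<lambda>x. (g, x))"
    using assms topspace_eq by (intro continuous_map_pairedI) auto
  from continuous_map_compose[OF this continuous_mult] show ?thesis by (simp add: o_def)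
qed

lemma mem_l_coset_iff:
  assumes "g \<in> carrier G" "B \<subseteq> carrier G" "x \<in> carrier G"
  shows "x \<in> g <# B \<longleftrightarrow> inv g \<otimes> x \<in> B"
proof
  assume "x \<in> g <# B"
  then show "inv g \<otimes> x \<in> B"
    using assms by (auto simp: l_coset_def m_assoc[symmetric] subset_iff)
next
  assume "inv g \<otimes> x \<in> B"
  moreover have "x = g \<otimes> (inv g \<otimes> x)"
    using assms by (simp add: m_assoc[symmetric])
  ultimately show "x \<in> g <# B" unfolding l_coset_def by blast
qed

lemma l_coset_subset_carrier: "g \<in> carrier G \<Longrightarrow> B \<subseteq> carrier G \<Longrightarrow> g <# B \<subseteq> carrier G"
  by (auto simp: l_coset_def)

lemma openin_l_coset:
  assumes "openin T U" "g \<in> carrier G"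
  shows "openin T (g <# U)"
proof -
  have U: "U \<subseteq> carrier G" using assms openin_subset_carrier by blast
  have "g <# U = {x \<in> topspace T. inv g \<otimes> x \<in> U}"
    using mem_l_coset_iff[OF assms(2) U] l_coset_subset_carrier[OF assms(2) U] topspace_eq by blast
  then show ?thesis
    using openin_continuous_map_preimage[OF continuous_l_mult[OF inv_closed[OF assms(2)]] assms(1)] by simp
qed

lemma compactin_l_coset:
  assumes "compactin T K" "g \<in> carrier G"
  shows "compactin T (g <# K)"
proof -
  have "g <# K = (\<lambda>x. g \<otimes> x) ` K" by (auto simp: l_coset_def)
  then show ?thesis using image_compactin[OF assms(1) continuous_l_mult[OF assms(2)]] by simp
qed

lemma openin_set_mult:
  assumes "openin T U" "P \<subseteq> carrier G"
  shows "openin T (P <#> U)"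
proof -
  have "P <#> U = (\<Union>p\<in>P. p <# U)" by (auto simp: l_coset_def set_mult_def)
  moreover have "openin T (\<Union>p\<in>P. p <# U)"
    using assms openin_l_coset by blast
  ultimately show ?thesis by simp
qed

lemma compactin_set_mult:
  assumes "compactin T K" "compactin T L"
  shows "compactin T (K <#> L)"
proof -
  have "K <#> L = (\<lambda>(x, y). x \<otimes> y) ` (K \<times> L)" by (auto simp: set_mult_def)
  moreover have "compactin (prod_topology T T) (K \<times> L)"
    using assms by (simp add: compactin_Times)
  ultimately show ?thesis using image_compactin[OF _ continuous_mult] by metis
qed

lemma compactin_set_inv:
  assumes "compactin T K"
  shows "compactin T (set_inv K)"
proof -
  have "set_inv K = (\<lambda>x. inv x) ` K" by (auto simp: SET_INV_def)
  then show ?thesis using image_compactin[OF assms continuous_inv] by simp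
qed

lemma nhds_mult:
  assumes "openin T W" "x \<in> carrier G" "y \<in> carrier G" "x \<otimes> y \<in> W"
  obtains A B where "openin T A" "openin T B" "x \<in> A" "y \<in> B" "\<And>a b. a \<in> A \<Longrightarrow> b \<in> B \<Longrightarrow> a \<otimes> b \<in> W"
proof -
  let ?P = "{z \<in> topspace (prod_topology T T). (\<lambda>(x, y). x \<otimes> y) z \<in> W}"
  have "openin (prod_topology T T) ?P"
    by (rule openin_continuous_map_preimage[OF continuous_mult assms(1)])
  then have "\<exists>A B. openin T A \<and> openin T B \<and> x \<in> A \<and> y \<in> B \<and> A \<times> B \<subseteq> ?P"
    by (rule openin_prod_topology_alt[THEN iffD1, rule_format]) (use assms topspace_eq in simp)
  then obtain A B where AB: "openin T A" "openin T B" "x \<in> A" "y \<in> B" "A \<times> B \<subseteq> ?P"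
    by (elim exE conjE)
  have "a \<otimes> b \<in> W" if "a \<in> A" "b \<in> B" for a b
  proof -
    have "(a, b) \<in> ?P" using that by (intro subsetD[OF AB(5)] SigmaI)
    then show ?thesis by simp
  qed
  then show thesis by (rule that[OF AB(1-4)])
qed

lemma symmetric_nhd_one:
  assumes "openin T N" "\<one> \<in> N"
  obtains S where "openin T S" "\<one> \<in> S" "S \<subseteq> N" "\<And>x. x \<in> S \<Longrightarrow> inv x \<in> S"
    "\<And>x y. x \<in> S \<Longrightarrow> y \<in> S \<Longrightarrow> x \<otimes> y \<in> N"
proof -
  obtain A B where AB: "openin T A" "openin T B" "\<one> \<in> A" "\<one> \<in> B"
      "\<And>a b. a \<in> A \<Longrightarrow> b \<in> B \<Longrightarrow> a \<otimes> b \<in> N"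
    using nhds_mult[OF assms(1), of \<one> \<one>] assms(2) by auto
  define D where "D = A \<inter> B \<inter> N"
  define S where "S = D \<inter> {x \<in> topspace T. inv x \<in> D}"
  have D: "openin T D" "\<one> \<in> D" using AB assms by (auto simp: D_def)
  show thesis
  proof (rule that[of S])
    show "openin T S"
      unfolding S_def using D openin_continuous_map_preimage[OF continuous_inv D(1)] by auto
    show "\<one> \<in> S" using D topspace_eq by (auto simp: S_def)
    show "S \<subseteq> N" by (auto simp: S_def D_def)
    show "inv x \<in> S" if "x \<in> S" for x using that topspace_eq by (auto simp: S_def)
    show "x \<otimes> y \<in> N" if "x \<in> S" "y \<in> S" for x y using that AB(5) by (auto simp: S_def D_def)
  qed
qed

lemma compactin_cover_l_cosets:
  assumes K: "compactin T K" and N: "openin T N" "\<one> \<in> N"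
  obtains F where "finite F" "F \<subseteq> K" "K \<subseteq> (\<Union>f\<in>F. f <# N)"
proof -
  have Kc: "K \<subseteq> carrier G" using K compactin_subset_carrier by blast
  have "K \<subseteq> \<Union>((\<lambda>k. k <# N) ` K)"
  proof
    fix k assume "k \<in> K"
    then have "k = k \<otimes> \<one>" using Kc by auto
    then show "k \<in> \<Union>((\<lambda>k. k <# N) ` K)" using \<open>k \<in> K\<close> N unfolding l_coset_def by blast
  qed
  moreover have "\<forall>U\<in>(\<lambda>k. k <# N) ` K. openin T U" using Kc N openin_l_coset by auto
  ultimately obtain \<F> where "finite \<F>" "\<F> \<subseteq> (\<lambda>k. k <# N) ` K" "K \<subseteq> \<Union>\<F>"
    using compactinD[OF K] by metis
  then show thesis using that by (metis finite_subset_image)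
qed

text \<open>Continuity of multiplication at (p, 1), needed for finitely many p by compactness, gives
  uniform room around \<open>P\<close> inside \<open>W\<close>.\<close>

lemma nhd_one_of_compactin:
  assumes P: "compactin T P" and W: "openin T W" "P \<subseteq> W"
  obtains N where "openin T N" "\<one> \<in> N" "\<And>p n. p \<in> P \<Longrightarrow> n \<in> N \<Longrightarrow> p \<otimes> n \<in> W"
proof -
  have Pc: "P \<subseteq> carrier G" using P compactin_subset_carrier by blast
  define R where "R p A B \<longleftrightarrow>
      openin T A \<and> openin T B \<and> p \<in> A \<and> \<one> \<in> B \<and> (\<forall>a\<in>A. \<forall>b\<in>B. a \<otimes> b \<in> W)" for p A B
  have "\<exists>A B. R p A B" if "p \<in> P" for p
  proof -
    have p: "p \<in> carrier G" "p \<otimes> \<one> \<in> W" using that Pc W(2) by (auto simp: subset_iff)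
    obtain A B where "openin T A" "openin T B" "p \<in> A" "\<one> \<in> B" "\<And>a b. a \<in> A \<Longrightarrow> b \<in> B \<Longrightarrow> a \<otimes> b \<in> W"
      by (rule nhds_mult[OF W(1) p(1) one_closed p(2)]) (rule that)
    then show ?thesis unfolding R_def by blast
  qed
  then obtain A B where "\<And>p. p \<in> P \<Longrightarrow> R p (A p) (B p)" by metis
  then have AB: "\<And>p. p \<in> P \<Longrightarrow> openin T (A p)" "\<And>p. p \<in> P \<Longrightarrow> openin T (B p)"
      "\<And>p. p \<in> P \<Longrightarrow> p \<in> A p" "\<And>p. p \<in> P \<Longrightarrow> \<one> \<in> B p"
      "\<And>p a b. p \<in> P \<Longrightarrow> a \<in> A p \<Longrightarrow> b \<in> B p \<Longrightarrow> a \<otimes> b \<in> W"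
    unfolding R_def by blast+
  have "P \<subseteq> \<Union>(A ` P)" "\<forall>U\<in>A ` P. openin T U" using AB by auto
  then obtain F where F: "finite F" "F \<subseteq> P" "P \<subseteq> \<Union>(A ` F)"
    using compactinD[OF P] by (metis finite_subset_image)
  \<comment> \<open>For empty \<open>F\<close> the intersection over \<open>B\<close> is
    \<open>UNIV\<close>; intersecting with \<open>topspace T\<close> keeps the neighbourhood inside
    the group.\<close>
  show thesis
  proof (rule that[of "topspace T \<inter> \<Inter>(B ` F)"])
    show "openin T (topspace T \<inter> \<Inter>(B ` F))"
      using F AB by (cases "F = {}") (auto intro!: openin_Int openin_Inter)
    show "\<one> \<in> topspace T \<inter> \<Inter>(B ` F)" using F AB topspace_eq by auto
    show "p \<otimes> n \<in> W" if "p \<in> P" "n \<in> topspace T \<inter> \<Inter>(B ` F)" for p n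
      using that F AB(5) by blast
  qed
qed

lemma openin_singleton_one_imp_discrete:
  assumes "openin T {\<one>}"
  shows "T = discrete_topology (carrier G)"
proof -
  have "openin T {g}" if "g \<in> carrier G" for g
  proof -
    have "g <# {\<one>} = {g}" using that by (simp add: l_coset_def)
    then show ?thesis using openin_l_coset[OF assms that] by simp
  qed
  then show ?thesis using topspace_eq discrete_topology_unique by metis
qed

lemma locally_compact_nhd_one:
  assumes "locally_compact_space T" "openin T N" "\<one> \<in> N"
  obtains U O' where "compactin T U" "openin T O'" "\<one> \<in> O'" "O' \<subseteq> U" "U \<subseteq> N"
proof -
  have "neighbourhood_base_of (compactin T) T"
    using assms(1) locally_compact_space_neighbourhood_base Hausdorff by blast
  then have "\<exists>O' U. openin T O' \<and> compactin T U \<and> \<one> \<in> O' \<and> O' \<subseteq> U \<and> U \<subseteq> N"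
    by (rule neighbourhood_base_of[THEN iffD1, rule_format]) (use assms in simp)
  then show thesis by (elim exE conjE) (rule that)
qed

end

section \<open>Haar measure on abelian groups\<close>

locale abelian_haar_group = topological_group G T + comm_group G
  for G (structure) and T +
  fixes \<mu> :: "'a measure"
  assumes locally_compact: "locally_compact_space T"
    and haar: "left_haar_measure G T \<mu>"
begin

lemma sets_openin: "openin T U \<Longrightarrow> U \<in> sets \<mu>"
  using haar by (auto simp: left_haar_measure_def intro: sigma_sets.Basic)

lemma sets_compactin:
  assumes "compactin T K"
  shows "K \<in> sets \<mu>"
proof -
  have "closedin T K" using assms compactin_imp_closedin Hausdorff by blast
  then have "openin T (topspace T - K)" "K = topspace T - (topspace T - K)"
    by (auto dest: closedin_subset)
  moreover have "topspace T = space \<mu>" using haar by (auto simp: left_haar_measure_def)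
  ultimately show ?thesis using sets_openin sets.compl_sets by metis
qed

lemma fmeasurable_compactin: "compactin T K \<Longrightarrow> K \<in> fmeasurable \<mu>"
  using haar sets_compactin by (auto simp: left_haar_measure_def intro!: fmeasurableI)

lemma emeasure_l_coset:
  "g \<in> carrier G \<Longrightarrow> B \<in> sets \<mu> \<Longrightarrow> emeasure \<mu> (g <# B) = emeasure \<mu> B"
  using haar by (auto simp: left_haar_measure_def)

lemma measure_l_coset:
  "g \<in> carrier G \<Longrightarrow> B \<in> sets \<mu> \<Longrightarrow> measure \<mu> (g <# B) = measure \<mu> B"
  by (simp add: measure_def emeasure_l_coset)

lemma outer_regular:
  assumes B: "B \<in> fmeasurable \<mu>" and "0 < \<epsilon>"
  obtains U where "openin T U" "B \<subseteq> U" "U \<in> fmeasurable \<mu>" "measure \<mu> U < measure \<mu> B + \<epsilon>"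
proof -
  have "(INF U\<in>{U. openin T U \<and> B \<subseteq> U}. emeasure \<mu> U) = emeasure \<mu> B"
    using haar fmeasurableD[OF B] by (auto simp: left_haar_measure_def)
  also have "\<dots> < ennreal (measure \<mu> B + \<epsilon>)"
    using assms by (simp add: emeasure_eq_measure2 ennreal_less_iff)
  finally obtain U where U: "openin T U" "B \<subseteq> U" "emeasure \<mu> U < ennreal (measure \<mu> B + \<epsilon>)"
    by (auto simp: INF_less_iff)
  then have "U \<in> fmeasurable \<mu>"
    using sets_openin by (intro fmeasurableI) (auto intro: less_trans[OF _ ennreal_less_top])
  moreover from this have "measure \<mu> U < measure \<mu> B + \<epsilon>"
    using U(3) by (simp add: emeasure_eq_measure2 ennreal_less_iff)
  ultimately show thesis using that U by blast
qed

lemma inner_regular: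
  assumes U: "openin T U" "U \<in> fmeasurable \<mu>" and "0 < \<epsilon>"
  obtains K where "compactin T K" "K \<subseteq> U" "measure \<mu> U - \<epsilon> < measure \<mu> K"
proof (cases "measure \<mu> U = 0")
  case True
  then show thesis using that[of "{}"] assms by auto
next
  case False
  \<comment> \<open>\<open>ennreal\<close> truncates negative numbers to 0, so strictness needs
    \<open>measure \<mu> U\<close> to be positive.\<close>
  then have "ennreal (measure \<mu> U - \<epsilon>) < emeasure \<mu> U"
    using assms by (auto simp: emeasure_eq_measure2 zero_less_measure_iff intro!: ennreal_lessI)
  also have "emeasure \<mu> U = (SUP K\<in>{K. compactin T K \<and> K \<subseteq> U}. emeasure \<mu> K)"
    using haar U by (auto simp: left_haar_measure_def)
  finally obtain K where K: "compactin T K" "K \<subseteq> U" "ennreal (measure \<mu> U - \<epsilon>) < emeasure \<mu> K"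
    by (auto simp: less_SUP_iff)
  then have "measure \<mu> U - \<epsilon> < measure \<mu> K"
    using fmeasurable_compactin[OF K(1)] measure_nonneg[of \<mu> K]
    by (cases "0 \<le> measure \<mu> U - \<epsilon>") (auto simp: emeasure_eq_measure2 ennreal_less_iff simp del: measure_nonneg)
  then show thesis using that K by blast
qed

text \<open>Finitely many translates of a null neighbourhood would cover any given compact set, so
  all compact sets would be null, and by inner regularity the whole group.\<close>

lemma emeasure_nhd_one_pos:
  assumes N: "openin T N" "\<one> \<in> N"
  shows "emeasure \<mu> N \<noteq> 0"
proof
  assume zero: "emeasure \<mu> N = 0"
  have null: "emeasure \<mu> K = 0" if K: "compactin T K" for K
  proof -
    obtain F where F: "finite F" "F \<subseteq> K" "K \<subseteq> (\<Union>f\<in>F. f <# N)"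
      using compactin_cover_l_cosets[OF K N] .
    have Fc: "F \<subseteq> carrier G" using F(2) compactin_subset_carrier[OF K] by blast
    have "f <# N \<in> null_sets \<mu>" if "f \<in> F" for f
      using that Fc N zero sets_openin openin_l_coset emeasure_l_coset by (intro null_setsI) auto
    then have "(\<Union>f\<in>F. f <# N) \<in> null_sets \<mu>"
      using F(1) by (intro null_sets.finite_UN) auto
    then show ?thesis using F(3) sets_compactin[OF K] null_sets_subset by blast
  qed
  have "emeasure \<mu> (topspace T) = (SUP K\<in>{K. compactin T K \<and> K \<subseteq> topspace T}. emeasure \<mu> K)"
    using haar by (auto simp: left_haar_measure_def)
  also have "\<dots> = 0" using null by (auto simp: SUP_eq_const intro!: antisym SUP_least)
  finally show False using haar by (auto simp: left_haar_measure_def)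
qed

lemma measure_pos:
  assumes "B \<in> fmeasurable \<mu>" "openin T N" "\<one> \<in> N" "N \<subseteq> B"
  shows "0 < measure \<mu> B"
proof (rule ccontr)
  assume "\<not> ?thesis"
  then have "emeasure \<mu> B = 0" using assms(1) by (simp add: emeasure_eq_measure2 zero_less_measure_iff)
  then have "emeasure \<mu> N = 0" using assms sets_openin by (metis emeasure_mono fmeasurableD le_zero_eq)
  then show False using emeasure_nhd_one_pos assms by blast
qed

text \<open>All points have equal mass. In a nondiscrete group a neighbourhood of the identity
  inside a compact set is infinite, so positive mass would contradict the finite measure of that
  compact set.\<close>

lemma measure_one_eq_0:
  assumes "T \<noteq> discrete_topology (carrier G)"
  shows "measure \<mu> {\<one>} = 0"
proof -
  have "openin T (carrier G)" using topspace_eq openin_topspace by metis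
  then obtain U O' where UO: "compactin T U" "openin T O'" "\<one> \<in> O'" "O' \<subseteq> U"
    using locally_compact_nhd_one[OF locally_compact _ one_closed] by metis
  have "infinite O'"
  proof
    assume fin: "finite O'"
    have "closedin T (O' - {\<one>})"
      using fin UO Hausdorff openin_subset[OF UO(2)]
      by (intro compactin_imp_closedin finite_imp_compactin) auto
    then have "openin T (O' - (O' - {\<one>}))" using UO by (intro openin_diff)
    moreover have "O' - (O' - {\<one>}) = {\<one>}" using UO by auto
    ultimately show False using openin_singleton_one_imp_discrete assms by simp
  qed
  have bound: "real n * measure \<mu> {\<one>} \<le> measure \<mu> U" for n
  proof -
    obtain F where F: "finite F" "card F = n" "F \<subseteq> O'"
      using infinite_arbitrarily_large[OF \<open>infinite O'\<close>] by blast
    have Fc: "F \<subseteq> carrier G" using F openin_subset_carrier[OF UO(2)] by blast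
    have one: "{\<one>} \<in> fmeasurable \<mu>"
      using topspace_eq by (intro fmeasurable_compactin finite_imp_compactin) auto
    have sing: "{g} \<in> fmeasurable \<mu>" "measure \<mu> {g} = measure \<mu> {\<one>}" if "g \<in> F" for g
    proof -
      have g: "g \<in> carrier G" using that Fc by blast
      have "g <# {\<one>} = {g}" using g by (simp add: l_coset_def)
      then show "measure \<mu> {g} = measure \<mu> {\<one>}"
        using measure_l_coset[OF g fmeasurableD[OF one]] by simp
      show "{g} \<in> fmeasurable \<mu>"
        using topspace_eq g by (intro fmeasurable_compactin finite_imp_compactin) auto
    qed
    have "real n * measure \<mu> {\<one>} = (\<Sum>g\<in>F. measure \<mu> {g})" using sing(2) F by simp
    also have "\<dots> = measure \<mu> (\<Union>g\<in>F. {g})"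
      using F sing(1) by (intro measure_UNION'[symmetric]) (auto simp: pairwise_def)
    also have "\<dots> \<le> measure \<mu> U"
      using F UO fmeasurable_compactin[OF UO(1)] sing(1)
      by (intro measure_mono_fmeasurable sets.finite_UN) (auto dest: fmeasurableD)
    finally show ?thesis .
  qed
  show ?thesis
  proof (rule ccontr)
    assume "measure \<mu> {\<one>} \<noteq> 0"
    then have "0 < measure \<mu> {\<one>}" by (simp add: zero_less_measure_iff)
    then obtain n where "measure \<mu> U < real n * measure \<mu> {\<one>}" using reals_Archimedean3 by blast
    with bound[of n] show False by simp
  qed
qed

text \<open>Absence of atoms in the form that the spreading lemma requires: outer regularity at the
  identity gives one small neighbourhood, and its translates cover.\<close>

lemma small_cover:
  assumes nd: "T \<noteq> discrete_topology (carrier G)" and K: "compactin T K" and "0 < \<epsilon>"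
  shows "\<exists>F. finite F \<and> F \<subseteq> fmeasurable \<mu> \<and> K \<subseteq> \<Union>F \<and> (\<forall>B\<in>F. measure \<mu> B < \<epsilon>)"
proof -
  have "{\<one>} \<in> fmeasurable \<mu>"
    using topspace_eq by (intro fmeasurable_compactin finite_imp_compactin) auto
  then obtain N where N: "openin T N" "\<one> \<in> N" "N \<in> fmeasurable \<mu>" "measure \<mu> N < \<epsilon>"
    using outer_regular[of "{\<one>}" \<epsilon>] measure_one_eq_0[OF nd] assms(3) by auto
  obtain F where F: "finite F" "F \<subseteq> K" "K \<subseteq> (\<Union>f\<in>F. f <# N)"
    using compactin_cover_l_cosets[OF K N(1,2)] .
  have "f <# N \<in> fmeasurable \<mu> \<and> measure \<mu> (f <# N) < \<epsilon>" if "f \<in> F" for f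
  proof -
    have "f \<in> carrier G" using that F(2) compactin_subset_carrier[OF K] by blast
    then show ?thesis
      using N emeasure_l_coset measure_l_coset sets_openin openin_l_coset
      by (auto simp: fmeasurable_def)
  qed
  then show ?thesis using F by (intro exI[of _ "(\<lambda>f. f <# N) ` F"]) auto
qed

end

section \<open>The compact null set\<close>

context topological_group
begin

definition compact_nhd_one :: "'a set \<Rightarrow> bool" where
  "compact_nhd_one U \<longleftrightarrow> compactin T U \<and> (\<exists>O'. openin T O' \<and> \<one> \<in> O' \<and> O' \<subseteq> U)"

text \<open>One move in the sequence of corrections: \<open>y <# U\<close> is the range open to
  later corrections, \<open>a <# U'\<close> the next, smaller range. Quantifying over
  \<open>u\<close> and \<open>v\<close> makes avoidance hold for every later correction in that
  range, so also for a limit, and for all points near \<open>s\<close>. Density is controlled only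
  at positions in \<open>K\<close>, hence the condition on \<open>y \<otimes> s\<close>.\<close>

definition avoidable :: "'a set \<Rightarrow> nat \<Rightarrow> 'a set \<Rightarrow> 'a set \<Rightarrow> 'a set \<Rightarrow> 'a set \<Rightarrow> bool" where
  "avoidable K h U U' V W \<longleftrightarrow>
     (\<forall>y\<in>carrier G. \<forall>S. finite S \<and> card S \<le> h \<and> S \<subseteq> carrier G \<and> (\<forall>s\<in>S. y \<otimes> s \<in> K) \<longrightarrow>
        (\<exists>a\<in>carrier G. a <# U' \<subseteq> y <# U \<and> (\<forall>s\<in>S. \<forall>u\<in>U'. \<forall>v\<in>V. a \<otimes> u \<otimes> (s \<otimes> v) \<notin> W)))"

lemma compact_nhd_one_subset_carrier: "compact_nhd_one U \<Longrightarrow> U \<subseteq> carrier G"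
  using compactin_subset_carrier by (auto simp: compact_nhd_one_def)

lemma one_in_compact_nhd: "compact_nhd_one U \<Longrightarrow> \<one> \<in> U"
  by (auto simp: compact_nhd_one_def)

lemma exists_compact_nhd_one:
  assumes "locally_compact_space T" "openin T N" "\<one> \<in> N"
  obtains U where "compact_nhd_one U" "U \<subseteq> N"
proof -
  obtain U O' where "compactin T U" "openin T O'" "\<one> \<in> O'" "O' \<subseteq> U" "U \<subseteq> N"
    using locally_compact_nhd_one[OF assms] .
  then show thesis by (intro that[of U]) (auto simp: compact_nhd_one_def)
qed

end

context abelian_haar_group
begin

lemma fmeasurable_nhd: "compact_nhd_one U \<Longrightarrow> U \<in> fmeasurable \<mu>"
  by (simp add: compact_nhd_one_def fmeasurable_compactin)

lemma measure_nhd_pos: "compact_nhd_one U \<Longrightarrow> 0 < measure \<mu> U"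
  using measure_pos[OF fmeasurable_nhd] by (auto simp: compact_nhd_one_def)

lemma sets_l_coset:
  assumes g: "g \<in> carrier G" and B: "B \<in> sets \<mu>"
  shows "g <# B \<in> sets \<mu>"
proof -
  have haar': "space \<mu> = topspace T" "sets \<mu> = sigma_sets (topspace T) {U. openin T U}"
    using haar by (auto simp: left_haar_measure_def)
  have "(\<lambda>x. inv g \<otimes> x) \<in> measurable \<mu> \<mu>"
  proof (rule measurable_sigma_sets[OF haar'(2)])
    show "{U. openin T U} \<subseteq> Pow (topspace T)" using openin_subset by blast
    show "(\<lambda>x. inv g \<otimes> x) \<in> space \<mu> \<rightarrow> topspace T" using g haar'(1) topspace_eq by auto
    show "(\<lambda>x. inv g \<otimes> x) -` U \<inter> space \<mu> \<in> sets \<mu>" if "U \<in> {U. openin T U}" for U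
    proof -
      have "openin T {x \<in> topspace T. inv g \<otimes> x \<in> U}"
        using that openin_continuous_map_preimage[OF continuous_l_mult[OF inv_closed[OF g]]] by blast
      moreover have "(\<lambda>x. inv g \<otimes> x) -` U \<inter> space \<mu> = {x \<in> topspace T. inv g \<otimes> x \<in> U}"
        using haar'(1) by auto
      ultimately show ?thesis using sets_openin by simp
    qed
  qed
  from measurable_sets[OF this B] have "(\<lambda>x. inv g \<otimes> x) -` B \<inter> space \<mu> \<in> sets \<mu>" .
  moreover have "B \<subseteq> carrier G" using sets.sets_into_space[OF B] haar'(1) topspace_eq by simp
  then have "(\<lambda>x. inv g \<otimes> x) -` B \<inter> space \<mu> = g <# B"
    using mem_l_coset_iff[OF g, of B] l_coset_subset_carrier[OF g, of B] haar'(1) topspace_eq by blast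
  ultimately show ?thesis by simp
qed

lemma fmeasurable_l_coset:
  assumes "g \<in> carrier G" "B \<in> fmeasurable \<mu>"
  shows "g <# B \<in> fmeasurable \<mu>"
  using assms emeasure_l_coset[of g B] sets_l_coset[of g B] by (auto simp: fmeasurable_def)

text \<open>Union bound: by commutativity the elements of \<open>y <# U\<close> that carry
  \<open>s\<close> into \<open>W\<close> form a translate of
  \<open>W \<inter> ((y \<otimes> s) <# U)\<close>. At most \<open>h\<close> such sets, each of
  measure less than \<open>measure \<mu> U / real h\<close>, cannot cover
  \<open>y <# U\<close>.\<close>

lemma exists_translate_avoiding:
  assumes U: "compact_nhd_one U" and W: "openin T W" "W \<in> fmeasurable \<mu>" and y: "y \<in> carrier G"
    and S: "finite S" "card S \<le> h" "S \<subseteq> carrier G"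
    and small: "\<And>s. s \<in> S \<Longrightarrow> measure \<mu> (W \<inter> ((y \<otimes> s) <# U)) < measure \<mu> U / real h"
  obtains a where "a \<in> y <# U" "\<And>s. s \<in> S \<Longrightarrow> a \<otimes> s \<notin> W"
proof -
  have Uc: "U \<subseteq> carrier G" using U compact_nhd_one_subset_carrier by blast
  have Wc: "W \<subseteq> carrier G" using W openin_subset_carrier by blast
  have yU: "compactin T (y <# U)" using U y compactin_l_coset by (auto simp: compact_nhd_one_def)
  have yUc: "y <# U \<subseteq> carrier G" using yU compactin_subset_carrier by blast
  define B where "B s = inv s <# (W \<inter> ((y \<otimes> s) <# U))" for s
  have D: "W \<inter> ((y \<otimes> s) <# U) \<in> fmeasurable \<mu>" "W \<inter> ((y \<otimes> s) <# U) \<subseteq> carrier G"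
    if "s \<in> S" for s
  proof -
    have "compactin T ((y \<otimes> s) <# U)"
      using U y that S(3) compactin_l_coset by (auto simp: compact_nhd_one_def)
    then show "W \<inter> ((y \<otimes> s) <# U) \<in> fmeasurable \<mu>"
      by (intro fmeasurable_Int_fmeasurable W(2) sets_compactin)
  qed (use Wc in blast)
  have B: "B s \<in> fmeasurable \<mu>" if "s \<in> S" for s
    unfolding B_def using D[OF that] S(3) that by (intro fmeasurable_l_coset) auto
  have meas_B: "measure \<mu> (B s) < measure \<mu> U / real h" if s: "s \<in> S" for s
  proof -
    have "inv s \<in> carrier G" using s S(3) by blast
    then have "measure \<mu> (B s) = measure \<mu> (W \<inter> ((y \<otimes> s) <# U))"
      unfolding B_def using measure_l_coset D(1)[OF s] fmeasurableD by blast
    then show ?thesis using small[OF s] by simp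
  qed
  have "measure \<mu> (\<Union>s\<in>S. B s) < measure \<mu> U"
  proof (cases "S = {}")
    case True
    then show ?thesis using measure_nhd_pos[OF U] by simp
  next
    case False
    have "measure \<mu> (\<Union>s\<in>S. B s) \<le> (\<Sum>s\<in>S. measure \<mu> (B s))"
      using S B by (intro measure_UNION_le) (auto dest: fmeasurableD)
    also have "\<dots> < (\<Sum>s\<in>S. measure \<mu> U / real h)"
      using S False meas_B by (intro sum_strict_mono) auto
    also have "\<dots> = real (card S) * (measure \<mu> U / real h)" by simp
    also have "\<dots> \<le> real h * (measure \<mu> U / real h)"
      using S by (intro mult_right_mono) auto
    also have "\<dots> \<le> measure \<mu> U" by simp
    finally show ?thesis .
  qed
  also have "measure \<mu> U = measure \<mu> (y <# U)"
    using measure_l_coset[OF y] fmeasurable_nhd[OF U] by (auto dest: fmeasurableD)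
  finally have "measure \<mu> (\<Union>s\<in>S. B s) < measure \<mu> (y <# U)" .
  then have "\<not> y <# U \<subseteq> (\<Union>s\<in>S. B s)"
    using S B sets_compactin[OF yU]
    by (metis fmeasurable.finite_UN measure_mono_fmeasurable not_le)
  then obtain a where a: "a \<in> y <# U" "\<And>s. s \<in> S \<Longrightarrow> a \<notin> B s" by blast
  have "a \<otimes> s \<notin> W" if s: "s \<in> S" for s
  proof
    assume "a \<otimes> s \<in> W"
    moreover have sc: "s \<in> carrier G" "a \<in> carrier G" using s S(3) a(1) yUc by blast+
    moreover obtain u where u: "u \<in> U" "a = y \<otimes> u" using a(1) by (auto simp: l_coset_def)
    moreover have "a \<otimes> s = (y \<otimes> s) \<otimes> u"
    proof -
      have "u \<in> carrier G" using u Uc by blast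
      then show ?thesis using u(2) y sc(1) by (simp add: m_ac)
    qed
    ultimately have "a \<otimes> s \<in> W \<inter> ((y \<otimes> s) <# U)" by (auto simp: l_coset_def)
    then have "a \<in> B s"
      unfolding B_def using mem_l_coset_iff[OF inv_closed[OF sc(1)] D(2)[OF s] sc(2)] sc
      by (simp add: m_comm)
    then show False using a(2)[OF s] by blast
  qed
  with a(1) show thesis by (rule that)
qed

text \<open>
  The set \<open>W\<close> is a thin neighbourhood of a compact set \<open>P\<close> whose density is about \<open>1/(8h)\<close> in \<open>A\<close>
  and less than \<open>1/h\<close> in every translate of a small \<open>U1 \<subseteq> U\<close>.  Hence of the translates by elements
  of \<open>y U1\<close> only a proportion less than \<open>1\<close> moves some point of an \<open>h\<close>-element set into \<open>W\<close>.
\<close>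

lemma exists_avoidable_open_set:
  assumes nd: "T \<noteq> discrete_topology (carrier G)" and U: "compact_nhd_one U"
    and K: "compactin T K" and A: "A \<in> sets \<mu>" "A \<subseteq> K" and h: "0 < h"
  obtains U' V W where "compact_nhd_one U'" "openin T V" "\<one> \<in> V" "openin T W"
    "measure \<mu> (A - W) \<le> (1 - 1 / (16 * real h)) * measure \<mu> A" "avoidable K h U U' V W"
proof -
  obtain O0 where O0: "openin T O0" "\<one> \<in> O0" "O0 \<subseteq> U" using U by (auto simp: compact_nhd_one_def)
  \<comment> \<open>\<open>U1\<close> and \<open>U'\<close> will both lie in \<open>S0\<close>, so
    that \<open>a <# U'\<close> stays in \<open>y <# U\<close> for every \<open>a\<close> in
    \<open>y <# U1\<close>.\<close>
  obtain S0 where S0: "openin T S0" "\<one> \<in> S0" "S0 \<subseteq> O0" "\<And>x y. x \<in> S0 \<Longrightarrow> y \<in> S0 \<Longrightarrow> x \<otimes> y \<in> O0"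
    by (rule symmetric_nhd_one[OF O0(1,2)]) (rule that)
  obtain U1 where U1: "compact_nhd_one U1" "U1 \<subseteq> S0"
    using exists_compact_nhd_one[OF locally_compact S0(1,2)] .
  have U1c: "U1 \<subseteq> carrier G" using U1(1) compact_nhd_one_subset_carrier by blast
  have U1f: "U1 \<in> fmeasurable \<mu>" using U1(1) by (rule fmeasurable_nhd)
  define m where "m = measure \<mu> U1"
  have m: "0 < m" using measure_nhd_pos[OF U1(1)] by (simp add: m_def)
  \<comment> \<open>The density condition concerns infinitely many translates of \<open>U1\<close>,
    whereas spreading handles finitely many sets. Each translate at a position in \<open>K\<close>
    lies in one of the finitely many \<open>f <# O2\<close>, at the price of less than doubling the
    measure.\<close>
  obtain O2 where O2: "openin T O2" "U1 \<subseteq> O2" "O2 \<in> fmeasurable \<mu>" "measure \<mu> O2 < m + m"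
    using outer_regular[OF U1f m] unfolding m_def .
  have "compactin T U1" using U1 by (simp add: compact_nhd_one_def)
  then obtain Q where Q: "openin T Q" "\<one> \<in> Q" "\<And>p q. p \<in> U1 \<Longrightarrow> q \<in> Q \<Longrightarrow> p \<otimes> q \<in> O2"
    by (rule nhd_one_of_compactin[OF _ O2(1,2)]) (rule that)
  obtain F where F: "finite F" "F \<subseteq> K" "K \<subseteq> (\<Union>f\<in>F. f <# Q)"
    using compactin_cover_l_cosets[OF K Q(1,2)] .
  have Fc: "F \<subseteq> carrier G" using F(2) compactin_subset_carrier[OF K] by blast
  have fO2: "f <# O2 \<in> fmeasurable \<mu>" "measure \<mu> (f <# O2) < 2 * m" if "f \<in> F" for f
    using that Fc O2 fmeasurable_l_coset measure_l_coset sets_openin by auto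
  have Af: "A \<in> fmeasurable \<mu>" using fmeasurableI2[OF fmeasurable_compactin[OF K] A(2,1)] .
  \<comment> \<open>\<open>E\<close> occupies at most \<open>t * (2 * m) = m / (2 * real h)\<close>
    of each \<open>f <# O2\<close>; another \<open>m / (2 * real h)\<close> is left for the open
    enlargement \<open>W'\<close>. The lower bound \<open>t / 2\<close> is halved once more in
    passing to the compact \<open>P\<close>, whence the 16.\<close>
  define t where "t = 1 / (4 * real h)"
  have t: "0 < t" "t \<le> 1" using h by (auto simp: t_def field_simps)
  have small: "\<exists>F. finite F \<and> F \<subseteq> fmeasurable \<mu> \<and> A \<subseteq> \<Union>F \<and> (\<forall>B\<in>F. measure \<mu> B < \<epsilon>)" if "0 < \<epsilon>" for \<epsilon>
    using small_cover[OF nd K that] A(2) by (meson subset_trans)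
  have FO2: "finite ((\<lambda>f. f <# O2) ` F)" "(\<lambda>f. f <# O2) ` F \<subseteq> sets \<mu>"
    using F(1) fO2(1) by (auto dest: fmeasurableD)
  obtain E where E: "E \<in> sets \<mu>" "E \<subseteq> A" "t / 2 * measure \<mu> A \<le> measure \<mu> E"
      "\<And>D. D \<in> (\<lambda>f. f <# O2) ` F \<Longrightarrow> measure \<mu> (E \<inter> D) \<le> t * measure \<mu> (A \<inter> D)"
    using exists_subset_spread_measure[OF FO2 Af t small] by blast
  have Ef: "E \<in> fmeasurable \<mu>" using fmeasurableI2[OF Af E(2,1)] .
  have E_small: "measure \<mu> (E \<inter> (f <# O2)) \<le> m / (2 * real h)" if f: "f \<in> F" for f
  proof -
    have "measure \<mu> (E \<inter> (f <# O2)) \<le> t * measure \<mu> (A \<inter> (f <# O2))" using E(4) f by blast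
    also have "measure \<mu> (A \<inter> (f <# O2)) \<le> measure \<mu> (f <# O2)"
      using fO2(1)[OF f] A(1) by (intro measure_mono_fmeasurable) (auto dest: fmeasurableD)
    also have "\<dots> \<le> 2 * m" using fO2(2)[OF f] by simp
    finally show ?thesis using t h by (simp add: t_def field_simps)
  qed
  show thesis
  proof (cases "measure \<mu> E = 0")
    \<comment> \<open>Here \<open>A\<close> is null as well, so nothing has to be removed.\<close>
    case True
    then have "t / 2 * measure \<mu> A \<le> 0" using E(3) by simp
    then have "measure \<mu> A \<le> 0" using t by (simp add: mult_le_0_iff)
    then have "measure \<mu> A = 0" by (intro order.antisym measure_nonneg)
    have "avoidable K h U U S0 {}"
      unfolding avoidable_def by blast
    then show thesis
      using that[of U S0 "{}"] U S0(1,2) \<open>measure \<mu> A = 0\<close> by simp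
  next
    case False
    then have Epos: "0 < measure \<mu> E" by (simp add: zero_less_measure_iff)
    obtain W' where W': "openin T W'" "E \<subseteq> W'" "W' \<in> fmeasurable \<mu>" "measure \<mu> W' < measure \<mu> E + m / (2 * real h)"
      using outer_regular[OF Ef, of "m / (2 * real h)"] m h by auto
    \<comment> \<open>The loss is at most half of \<open>measure \<mu> E\<close>, so
      \<open>P\<close> keeps half of \<open>E\<close> in measure. Compactness of \<open>P\<close>
      provides room inside \<open>W'\<close>: once \<open>a \<otimes> s\<close> avoids
      \<open>W'\<close>, its small perturbations avoid the smaller set \<open>W\<close>.\<close>
    obtain P where P: "compactin T P" "P \<subseteq> W'" "measure \<mu> W' - measure \<mu> E / 2 < measure \<mu> P"
      using inner_regular[OF W'(1,3), of "measure \<mu> E / 2"] Epos by auto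
    have Pc: "P \<subseteq> carrier G" using P(1) compactin_subset_carrier by blast
    have W'_small: "measure \<mu> (W' \<inter> (f <# O2)) < m / real h" if f: "f \<in> F" for f
    proof -
      have "measure \<mu> (W' \<inter> (f <# O2)) \<le> measure \<mu> ((E \<inter> (f <# O2)) \<union> (W' - E))"
        using W' E fO2(1)[OF f] Ef
        by (intro measure_mono_fmeasurable fmeasurable.Un fmeasurable_Diff fmeasurable_Int_fmeasurable)
           (auto dest: fmeasurableD)
      also have "\<dots> \<le> measure \<mu> (E \<inter> (f <# O2)) + measure \<mu> (W' - E)"
        using W' E fO2(1)[OF f] by (intro measure_Un_le) (auto dest: fmeasurableD)
      also have "measure \<mu> (W' - E) = measure \<mu> W' - measure \<mu> E"
        using W' E by (intro measurable_measure_Diff) auto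
      also have "measure \<mu> (E \<inter> (f <# O2)) + (measure \<mu> W' - measure \<mu> E) < m / (2 * real h) + m / (2 * real h)"
        using E_small[OF f] W'(4) by linarith
      also have "\<dots> = m / real h" by simp
      finally show ?thesis .
    qed
    \<comment> \<open>If \<open>a \<otimes> u \<otimes> (s \<otimes> v) = p \<otimes> n\<close>,
      then \<open>a \<otimes> s = p \<otimes> ((n \<otimes> inv v) \<otimes> inv u)\<close>. The
      three factors after \<open>p\<close> come from \<open>N3\<close>, and two halvings put their
      product into \<open>N1\<close>.\<close>
    obtain N1 where N1: "openin T N1" "\<one> \<in> N1" "\<And>p n. p \<in> P \<Longrightarrow> n \<in> N1 \<Longrightarrow> p \<otimes> n \<in> W'"
      by (rule nhd_one_of_compactin[OF P(1) W'(1) P(2)]) (rule that)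
    obtain N2 where N2: "openin T N2" "\<one> \<in> N2" "\<And>x y. x \<in> N2 \<Longrightarrow> y \<in> N2 \<Longrightarrow> x \<otimes> y \<in> N1"
      by (rule symmetric_nhd_one[OF N1(1,2)]) (rule that)
    obtain N3 where N3: "openin T N3" "\<one> \<in> N3" "N3 \<subseteq> N2" "\<And>x. x \<in> N3 \<Longrightarrow> inv x \<in> N3"
        "\<And>x y. x \<in> N3 \<Longrightarrow> y \<in> N3 \<Longrightarrow> x \<otimes> y \<in> N2"
      by (rule symmetric_nhd_one[OF N2(1,2)]) (rule that)
    have N3c: "N3 \<subseteq> carrier G" using N3(1) openin_subset_carrier by blast
    obtain U' where U': "compact_nhd_one U'" "U' \<subseteq> N3 \<inter> S0"
      using exists_compact_nhd_one[OF locally_compact openin_Int[OF N3(1) S0(1)]] N3(2) S0(2) by blast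
    define W where "W = P <#> N3"
    have W: "openin T W" unfolding W_def using N3(1) Pc by (rule openin_set_mult)
    have "P \<subseteq> W"
    proof
      fix p assume "p \<in> P"
      then have "p = p \<otimes> \<one>" using Pc by auto
      then show "p \<in> W" using \<open>p \<in> P\<close> N3(2) unfolding W_def set_mult_def by blast
    qed
    have "measure \<mu> (A - W) \<le> (1 - 1 / (16 * real h)) * measure \<mu> A"
    proof -
      have Pf: "P \<in> fmeasurable \<mu>" using fmeasurable_compactin P(1) by blast
      have EPf: "E \<inter> P \<in> fmeasurable \<mu>"
        using Ef Pf by (intro fmeasurable_Int_fmeasurable) (auto dest: fmeasurableD)
      have "measure \<mu> E + measure \<mu> P = measure \<mu> (E \<union> P) + measure \<mu> (E \<inter> P)"
        using measure_Un3[OF Ef Pf] by simp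
      moreover have "measure \<mu> (E \<union> P) \<le> measure \<mu> W'"
        using W' P(2) Ef Pf by (intro measure_mono_fmeasurable) (auto dest: fmeasurableD)
      ultimately have EP: "measure \<mu> E / 2 \<le> measure \<mu> (E \<inter> P)" using P(3) by linarith
      have "measure \<mu> (A - W) \<le> measure \<mu> (A - E \<inter> P)"
        using \<open>P \<subseteq> W\<close> Af EPf sets_openin[OF W]
        by (intro measure_mono_fmeasurable fmeasurable_Diff) (auto dest: fmeasurableD)
      also have "\<dots> = measure \<mu> A - measure \<mu> (E \<inter> P)"
        using Af EPf E(2) by (intro measurable_measure_Diff) (auto dest: fmeasurableD)
      also have "\<dots> \<le> measure \<mu> A - t / 4 * measure \<mu> A" using EP E(3) by simp
      also have "\<dots> = (1 - 1 / (16 * real h)) * measure \<mu> A"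
        by (simp add: t_def algebra_simps)
      finally show ?thesis .
    qed
    moreover have "avoidable K h U U' N3 W"
      unfolding avoidable_def
    proof (intro ballI allI impI)
      fix y S
      assume y: "y \<in> carrier G" and S: "finite S \<and> card S \<le> h \<and> S \<subseteq> carrier G \<and> (\<forall>s\<in>S. y \<otimes> s \<in> K)"
      have "measure \<mu> (W' \<inter> ((y \<otimes> s) <# U1)) < measure \<mu> U1 / real h" if s: "s \<in> S" for s
      proof -
        have "y \<otimes> s \<in> K" using S s by blast
        then obtain f where f: "f \<in> F" "y \<otimes> s \<in> f <# Q" using F(3) by blast
        then obtain q where q: "q \<in> Q" "y \<otimes> s = f \<otimes> q" by (auto simp: l_coset_def)
        have qc: "q \<in> carrier G" using q(1) Q(1) openin_subset_carrier by blast
        have fc: "f \<in> carrier G" using f Fc by blast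
        have "(y \<otimes> s) <# U1 \<subseteq> f <# O2"
        proof
          fix z assume "z \<in> (y \<otimes> s) <# U1"
          then obtain u where u: "u \<in> U1" "z = f \<otimes> q \<otimes> u" using q by (auto simp: l_coset_def)
          have "z = f \<otimes> (u \<otimes> q)"
            using u U1c qc fc by (simp add: m_assoc m_comm[of q u] subset_iff)
          moreover have "u \<otimes> q \<in> O2" using Q(3) u q by blast
          ultimately show "z \<in> f <# O2" by (auto simp: l_coset_def)
        qed
        moreover have "compactin T ((y \<otimes> s) <# U1)"
          using \<open>compactin T U1\<close> y s S compactin_l_coset by (metis m_closed subsetD)
        ultimately have "measure \<mu> (W' \<inter> ((y \<otimes> s) <# U1)) \<le> measure \<mu> (W' \<inter> (f <# O2))"
          using W'(3) fO2(1)[OF f(1)] sets_compactin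
          by (intro measure_mono_fmeasurable fmeasurable_Int_fmeasurable) (auto dest: fmeasurableD)
        then show ?thesis using W'_small[OF f(1)] by (simp add: m_def)
      qed
      then obtain a where a: "a \<in> y <# U1" "\<And>s. s \<in> S \<Longrightarrow> a \<otimes> s \<notin> W'"
        using exists_translate_avoiding[OF U1(1) W'(1,3) y, of S h] S by metis
      obtain u1 where u1: "u1 \<in> U1" "a = y \<otimes> u1" using a(1) by (auto simp: l_coset_def)
      have ac: "a \<in> carrier G" using u1 U1c y by auto
      have U'c: "U' \<subseteq> carrier G" using U'(1) compact_nhd_one_subset_carrier by blast
      show "\<exists>a\<in>carrier G. a <# U' \<subseteq> y <# U \<and> (\<forall>s\<in>S. \<forall>u\<in>U'. \<forall>v\<in>N3. a \<otimes> u \<otimes> (s \<otimes> v) \<notin> W)"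
      proof (intro bexI[OF _ ac] conjI ballI)
        show "a <# U' \<subseteq> y <# U"
        proof
          fix z assume "z \<in> a <# U'"
          then obtain u where u: "u \<in> U'" "z = a \<otimes> u" by (auto simp: l_coset_def)
          have "z = y \<otimes> (u1 \<otimes> u)" using u u1 U1c U'c y by (auto simp: m_assoc subset_iff)
          moreover have "u1 \<otimes> u \<in> U" using S0(4)[of u1 u] u u1 U1(2) U'(2) O0(3) by blast
          ultimately show "z \<in> y <# U" by (auto simp: l_coset_def)
        qed
        fix s u v assume s: "s \<in> S" and u: "u \<in> U'" and v: "v \<in> N3"
        show "a \<otimes> u \<otimes> (s \<otimes> v) \<notin> W"
        proof
          assume "a \<otimes> u \<otimes> (s \<otimes> v) \<in> W"
          then obtain p n where p: "p \<in> P" "n \<in> N3" "a \<otimes> u \<otimes> (s \<otimes> v) = p \<otimes> n"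
            unfolding W_def set_mult_def by blast
          have c: "u \<in> carrier G" "v \<in> carrier G" "s \<in> carrier G" "p \<in> carrier G" "n \<in> carrier G"
            using u v s p S U'c N3c Pc by auto
          have "a \<otimes> s = a \<otimes> u \<otimes> (s \<otimes> v) \<otimes> (inv v \<otimes> inv u)"
          proof -
            have "a \<otimes> u \<otimes> (s \<otimes> v) = (a \<otimes> s) \<otimes> (u \<otimes> v)"
              using c ac by (simp add: m_ac)
            then have "a \<otimes> u \<otimes> (s \<otimes> v) \<otimes> (inv v \<otimes> inv u) = (a \<otimes> s) \<otimes> ((u \<otimes> v) \<otimes> inv (u \<otimes> v))"
              using c ac by (simp add: m_assoc inv_mult_group)
            then show ?thesis using c ac by simp
          qed
          also have "\<dots> = p \<otimes> ((n \<otimes> inv v) \<otimes> inv u)"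
            using p(3) c by (simp add: m_assoc)
          finally have eq: "a \<otimes> s = p \<otimes> ((n \<otimes> inv v) \<otimes> inv u)" .
          have "n \<otimes> inv v \<in> N2" using N3(4,5) p(2) v by blast
          moreover have "inv u \<in> N2" using N3(3,4) u U'(2) by blast
          ultimately have "(n \<otimes> inv v) \<otimes> inv u \<in> N1" by (rule N2(3))
          then have "a \<otimes> s \<in> W'" unfolding eq by (rule N1(3)[OF p(1)])
          then show False using a(2) s by blast
        qed
      qed
    qed
    ultimately show thesis using that[OF U'(1) N3(1,2) W] by blast
  qed
qed

end

text \<open>
  Both measures are compared by evaluating \<open>\<Sum>\<^sub>i \<mu>(K\<^sub>i) \<nu>(x\<^sub>i\<^sup>-\<^sup>1 C)\<close>, where the \<open>K\<^sub>i\<close> partition \<open>K\<close>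
  into small pieces near \<open>x\<^sub>i\<close>; this is a discrete form of Fubini's theorem.
\<close>

lemma (in abelian_haar_group) null_for_other_haar_measure:
  assumes \<nu>: "left_haar_measure G T \<nu>" and C: "compactin T C" and null: "emeasure \<mu> C = 0"
  shows "emeasure \<nu> C = 0"
proof -
  interpret \<nu>: abelian_haar_group G T \<nu>
    using \<nu> locally_compact by unfold_locales
  have "openin T (carrier G)" using topspace_eq openin_topspace by metis
  then obtain K where K: "compact_nhd_one K"
    using exists_compact_nhd_one[OF locally_compact _ one_closed] by metis
  then have Kcomp: "compactin T K" by (simp add: compact_nhd_one_def)
  have Kc: "K \<subseteq> carrier G" using compact_nhd_one_subset_carrier[OF K] .
  have Cc: "C \<subseteq> carrier G" using compactin_subset_carrier[OF C] .
  \<comment> \<open>\<open>L\<close> contains \<open>inv x <# C\<close> for all \<open>x\<close> in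
    \<open>K\<close>, so it supports every sum in \<open>pointwise\<close>, and its finite measure
    does not depend on \<epsilon>.\<close>
  define L where "L = set_inv K <#> C"
  have L: "compactin T L" unfolding L_def using Kcomp C compactin_set_mult compactin_set_inv by blast
  have bound: "emeasure \<nu> C * emeasure \<mu> K \<le> ennreal \<epsilon> * emeasure \<nu> L" if \<epsilon>: "0 < \<epsilon>" for \<epsilon>
  proof -
    have "measure \<mu> C = 0" using null by (simp add: measure_def)
    then obtain W where W: "openin T W" "C \<subseteq> W" "W \<in> fmeasurable \<mu>" "measure \<mu> W < \<epsilon>"
      using outer_regular[OF fmeasurable_compactin[OF C] \<epsilon>] by auto
    obtain N where N: "openin T N" "\<one> \<in> N" "\<And>c n. c \<in> C \<Longrightarrow> n \<in> N \<Longrightarrow> c \<otimes> n \<in> W"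
      by (rule nhd_one_of_compactin[OF C W(1,2)]) (rule that)
    obtain F where F: "finite F" "F \<subseteq> K" "K \<subseteq> (\<Union>f\<in>F. f <# N)"
      using compactin_cover_l_cosets[OF Kcomp N(1,2)] .
    obtain x :: "nat \<Rightarrow> 'a" where x: "bij_betw x {0..<card F} F"
      using ex_bij_betw_nat_finite[OF F(1)] by blast
    define n where "n = card F"
    have xF: "x i \<in> F" if "i < n" for i using x that by (auto simp: n_def bij_betw_def)
    have xc: "x i \<in> carrier G" if "i < n" for i using xF[OF that] F(2) Kc by blast
    define A where "A i = (if i < n then K \<inter> (x i <# N) else {})" for i
    define P where "P = disjointed A"
    have "A i \<in> sets \<mu>" for i
      using N(1) xc openin_l_coset sets_openin sets_compactin[OF Kcomp] by (auto simp: A_def)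
    then have sets_P: "P i \<in> sets \<mu>" for i
      using sets.range_disjointed_sets[of A \<mu>] unfolding P_def by blast
    have disj: "disjoint_family_on P {0..<n}"
      using disjoint_family_disjointed[of A] unfolding P_def disjoint_family_on_def by blast
    have P_A: "P i \<subseteq> A i" for i unfolding P_def by (rule disjointed_subset)
    have UP: "(\<Union>i\<in>{0..<n}. P i) = K"
    proof -
      have "(\<Union>i\<in>{0..<n}. P i) = (\<Union>i\<in>{0..<n}. A i)" unfolding P_def by (rule finite_UN_disjointed_eq)
      also have "\<dots> = K \<inter> (\<Union>f\<in>x ` {0..<n}. f <# N)" by (auto simp: A_def)
      also have "x ` {0..<n} = F" using x by (simp add: bij_betw_def n_def)
      also have "K \<inter> (\<Union>f\<in>F. f <# N) = K" using F(3) by (rule Int_absorb2)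
      finally show ?thesis .
    qed
    define B where "B i = inv (x i) <# C" for i
    have Bcomp: "compactin T (B i)" if "i < n" for i
      unfolding B_def using C xc[OF that] by (intro compactin_l_coset) auto
    have sets_B: "B i \<in> sets \<nu>" if "i < n" for i using \<nu>.sets_compactin[OF Bcomp[OF that]] .
    have B_iff: "y \<in> B i \<longleftrightarrow> x i \<otimes> y \<in> C" if "i < n" "y \<in> carrier G" for i y
      unfolding B_def using mem_l_coset_iff[OF inv_closed[OF xc[OF that(1)]] Cc that(2)] xc[OF that(1)] by simp
    \<comment> \<open>For fixed \<open>y\<close>, only pieces with \<open>x i \<otimes> y\<close> in
      \<open>C\<close> contribute. A point \<open>x i \<otimes> m\<close> of such a piece,
      \<open>m\<close> in \<open>N\<close>, satisfies \<open>y \<otimes> (x i \<otimes> m) = (x i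
      \<otimes> y) \<otimes> m\<close>, which lies in \<open>W\<close>. So the disjoint pieces fit
      into \<open>inv y <# W\<close>, of measure less than \<epsilon>.\<close>
    have pointwise: "(\<Sum>i\<in>{0..<n}. emeasure \<mu> (P i) * indicator (B i) y) \<le> ennreal \<epsilon> * indicator L y" for y
    proof (cases "\<exists>i<n. y \<in> B i")
      case False
      then have "(\<Sum>i\<in>{0..<n}. emeasure \<mu> (P i) * indicator (B i) y) = 0"
        by (intro sum.neutral) (auto simp: indicator_def)
      then show ?thesis by simp
    next
      case True
      then obtain i where i: "i < n" "y \<in> B i" by blast
      then have yc: "y \<in> carrier G" using Bcomp compactin_subset_carrier by blast
      have "y \<in> L"
      proof -
        obtain c where "c \<in> C" "y = inv (x i) \<otimes> c" using i(2) by (auto simp: B_def l_coset_def)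
        moreover have "inv (x i) \<in> set_inv K" using xF[OF i(1)] F(2) by (auto simp: SET_INV_def)
        ultimately show ?thesis unfolding L_def set_mult_def by blast
      qed
      define J where "J = {i \<in> {0..<n}. y \<in> B i}"
      have "(\<Sum>i\<in>{0..<n}. emeasure \<mu> (P i) * indicator (B i) y) = (\<Sum>i\<in>J. emeasure \<mu> (P i))"
        unfolding J_def by (intro sum.mono_neutral_cong_right) auto
      also have "\<dots> = emeasure \<mu> (\<Union>i\<in>J. P i)"
        using sets_P disj by (intro sum_emeasure) (auto simp: J_def disjoint_family_on_def)
      also have "\<dots> \<le> emeasure \<mu> (inv y <# W)"
      proof (rule emeasure_mono)
        show "inv y <# W \<in> sets \<mu>" using W(1) yc openin_l_coset sets_openin by auto
        show "(\<Union>i\<in>J. P i) \<subseteq> inv y <# W"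
        proof
          fix z assume "z \<in> (\<Union>i\<in>J. P i)"
          then obtain j where j: "j < n" "y \<in> B j" "z \<in> A j" using P_A by (auto simp: J_def)
          then obtain m where m: "m \<in> N" "z = x j \<otimes> m" by (auto simp: A_def l_coset_def)
          have c: "m \<in> carrier G" "x j \<in> carrier G"
            using m(1) openin_subset_carrier[OF N(1)] xc[OF j(1)] by auto
          have "(x j \<otimes> y) \<otimes> m \<in> W" using N(3) B_iff[OF j(1) yc] j(2) m(1) by blast
          moreover have "y \<otimes> z = (x j \<otimes> y) \<otimes> m" using m c yc by (simp add: m_ac)
          moreover have "z \<in> carrier G" using m c by simp
          ultimately show "z \<in> inv y <# W"
            using mem_l_coset_iff[OF inv_closed[OF yc] openin_subset_carrier[OF W(1)]] yc by simp
        qed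
      qed
      also have "\<dots> = emeasure \<mu> W" using emeasure_l_coset yc W(1) sets_openin by simp
      also have "\<dots> \<le> ennreal \<epsilon>"
        using W(3,4) by (simp add: emeasure_eq_measure2 ennreal_leI)
      finally show ?thesis using \<open>y \<in> L\<close> by simp
    qed
    have "emeasure \<nu> C * emeasure \<mu> K = (\<Sum>i\<in>{0..<n}. emeasure \<mu> (P i)) * emeasure \<nu> C"
      using sum_emeasure[OF _ disj] sets_P UP by (simp add: image_subset_iff mult.commute)
    also have "\<dots> = (\<Sum>i\<in>{0..<n}. emeasure \<mu> (P i) * emeasure \<nu> (B i))"
    proof -
      have "emeasure \<nu> (B i) = emeasure \<nu> C" if "i < n" for i
        unfolding B_def using \<nu>.emeasure_l_coset \<nu>.sets_compactin[OF C] xc[OF that] by simp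
      then show ?thesis by (simp add: sum_distrib_right)
    qed
    also have "\<dots> = (\<integral>\<^sup>+ y. (\<Sum>i\<in>{0..<n}. emeasure \<mu> (P i) * indicator (B i) y) \<partial>\<nu>)"
      using sets_B by (subst nn_integral_sum) (auto simp: nn_integral_cmult_indicator)
    also have "\<dots> \<le> (\<integral>\<^sup>+ y. ennreal \<epsilon> * indicator L y \<partial>\<nu>)"
      using pointwise by (intro nn_integral_mono) auto
    also have "\<dots> = ennreal \<epsilon> * emeasure \<nu> L"
      using \<nu>.sets_compactin[OF L] by (rule nn_integral_cmult_indicator)
    finally show ?thesis .
  qed
  have Lf: "L \<in> fmeasurable \<nu>" and Cf: "C \<in> fmeasurable \<nu>" and Kf: "K \<in> fmeasurable \<mu>"
    using \<nu>.fmeasurable_compactin fmeasurable_compactin L C Kcomp by auto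
  have small: "measure \<nu> C * measure \<mu> K \<le> \<epsilon> * measure \<nu> L" if "0 < \<epsilon>" for \<epsilon>
  proof -
    have "ennreal (measure \<nu> C * measure \<mu> K) \<le> ennreal (\<epsilon> * measure \<nu> L)"
      using bound[OF that] Lf Cf Kf that by (simp add: emeasure_eq_measure2 ennreal_mult'')
    then show ?thesis using that by (simp add: ennreal_le_iff)
  qed
  have lim: "measure \<nu> C * measure \<mu> K \<le> (1 / real (Suc n)) * measure \<nu> L" for n
    by (rule small) simp
  have "(\<lambda>n. (1 / real (Suc n)) * measure \<nu> L) \<longlonglongrightarrow> 0 * measure \<nu> L"
    by (intro tendsto_mult tendsto_const LIMSEQ_Suc lim_1_over_n)
  then have "measure \<nu> C * measure \<mu> K \<le> 0 * measure \<nu> L"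
    by (rule LIMSEQ_le_const) (intro exI allI impI lim)
  then have "measure \<nu> C \<le> 0"
    using measure_nhd_pos[OF K] by (simp add: mult_le_0_iff)
  then have "measure \<nu> C = 0" by (intro order.antisym measure_nonneg)
  then show ?thesis using Cf by (simp add: emeasure_eq_measure2)
qed

section \<open>Iterated removals and the limit of the corrections\<close>

text \<open>From \<open>1 + x \<le> exp x\<close> the partial products are at most
  \<open>exp (- harm n / 16)\<close>.\<close>

lemma prod_one_minus_inverse_tendsto_0:
  "(\<lambda>n. \<Prod>i<n. 1 - 1 / (16 * real (Suc i))) \<longlonglongrightarrow> 0"
proof (rule tendsto_sandwich)
  have "(\<Prod>i<n. 1 - 1 / (16 * real (Suc i))) \<le> exp (- harm n / 16)" for n
  proof (induction n)
    case 0
    show ?case by (simp add: harm_def)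
  next
    case (Suc n)
    have "(\<Prod>i<Suc n. 1 - 1 / (16 * real (Suc i))) \<le> exp (- harm n / 16) * exp (- (1 / (16 * real (Suc n))))"
      using Suc exp_ge_add_one_self[of "- (1 / (16 * real (Suc n)))"]
      unfolding prod.lessThan_Suc by (intro mult_mono) auto
    also have "\<dots> = exp (- harm (Suc n) / 16)"
      by (simp add: harm_Suc exp_add[symmetric] field_simps)
    finally show ?case .
  qed
  then show "\<forall>\<^sub>F n in sequentially. (\<Prod>i<n. 1 - 1 / (16 * real (Suc i))) \<le> exp (- harm n / 16)" by simp
  show "\<forall>\<^sub>F n in sequentially. 0 \<le> (\<Prod>i<n. 1 - 1 / (16 * real (Suc i)))"
    by (intro always_eventually allI prod_nonneg) (auto simp: field_simps)
  have "filterlim (\<lambda>n. harm n / 16 :: real) at_top sequentially"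
    by (intro filterlim_at_top_mult_tendsto_pos[OF tendsto_const _ harm_at_top, of "1/16", simplified]) 
  then have "((\<lambda>n. exp (- (harm n / 16 :: real))) \<longlongrightarrow> 0) sequentially"
    by (intro filterlim_compose[OF exp_at_bot] filterlim_compose[OF filterlim_uminus_at_bot_at_top])
  then show "(\<lambda>n. exp (- harm n / 16 :: real)) \<longlonglongrightarrow> 0" by simp
qed simp

text \<open>The removals are carried out without reference to a slalom. For a given slalom,
  \<open>avoidable\<close> supplies each correction within the range of the previous one, and
  compactness of the nested ranges supplies the limit.\<close>

lemma (in abelian_haar_group) exists_compact_null_set_catching_slaloms:
  assumes nd: "T \<noteq> discrete_topology (carrier G)" and L: "compactin T L"
  obtains C V where "compactin T C" "emeasure \<mu> C = 0" "\<And>n. openin T (V n)" "\<And>n. \<one> \<in> V n"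
    "\<And>S :: nat \<Rightarrow> 'a set. \<forall>n. finite (S n) \<and> card (S n) \<le> Suc n \<and> S n \<subseteq> L \<Longrightarrow>
       \<exists>a\<in>carrier G. \<forall>x\<in>L. (\<forall>n. x \<in> S n <#> V n) \<longrightarrow> a \<otimes> x \<in> C"
proof -
  have "openin T (carrier G)" using topspace_eq openin_topspace by metis
  then obtain U0 where U0: "compact_nhd_one U0"
    using exists_compact_nhd_one[OF locally_compact _ one_closed] by metis
  have U0comp: "compactin T U0" using U0 by (simp add: compact_nhd_one_def)
  have U0c: "U0 \<subseteq> carrier G" using U0 by (rule compact_nhd_one_subset_carrier)
  have Lc: "L \<subseteq> carrier G" using compactin_subset_carrier[OF L] .
  \<comment> \<open>All corrections stay in \<open>U0\<close>, so \<open>K\<close> contains every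
    product of a correction with a point of \<open>L\<close>.\<close>
  define K where "K = U0 <#> L"
  have K: "compactin T K" unfolding K_def using U0comp L by (rule compactin_set_mult)
  \<comment> \<open>A state pairs the range neighbourhood with the union of the sets removed so far;
    \<open>V\<close> and \<open>W\<close> are extracted once the sequence of states is
    known.\<close>
  define Q where "Q n p p' V W \<longleftrightarrow> snd p' = snd p \<union> W \<and> openin T V \<and> \<one> \<in> V \<and> openin T W \<and>
      measure \<mu> (K - snd p - W) \<le> (1 - 1 / (16 * real (Suc n))) * measure \<mu> (K - snd p) \<and>
      avoidable K (Suc n) (fst p) (fst p') V W" for n and p p' :: "'a set \<times> 'a set" and V W
  \<comment> \<open>The conjunct about \<open>n = 0\<close> fixes the initial state of the dependent
    choice.\<close>
  have "\<exists>f. \<forall>n. (compact_nhd_one (fst (f n)) \<and> openin T (snd (f n)) \<and> (n = 0 \<longrightarrow> f n = (U0, {}))) \<and>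
      (\<exists>V W. Q n (f n) (f (Suc n)) V W)"
  proof (rule dependent_nat_choice)
    show "\<exists>p. compact_nhd_one (fst p) \<and> openin T (snd p) \<and> (0 = (0::nat) \<longrightarrow> p = (U0, {}))"
      using U0 by (intro exI[of _ "(U0, {})"]) simp
    fix p n
    assume p: "compact_nhd_one (fst p) \<and> openin T (snd p) \<and> (n = (0::nat) \<longrightarrow> p = (U0, {}))"
    have "K - snd p \<in> sets \<mu>" using p K sets_openin sets_compactin by auto
    then obtain U' V W where "compact_nhd_one U'" "openin T V" "\<one> \<in> V" "openin T W"
        "measure \<mu> (K - snd p - W) \<le> (1 - 1 / (16 * real (Suc n))) * measure \<mu> (K - snd p)"
        "avoidable K (Suc n) (fst p) U' V W"
      using exists_avoidable_open_set[OF nd _ K _ Diff_subset zero_less_Suc] p by metis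
    then have "Q n p (U', snd p \<union> W) V W" "compact_nhd_one U'" "openin T (snd p \<union> W)"
      using p by (auto simp: Q_def)
    then show "\<exists>p'. (compact_nhd_one (fst p') \<and> openin T (snd p') \<and> (Suc n = 0 \<longrightarrow> p' = (U0, {}))) \<and>
        (\<exists>V W. Q n p p' V W)"
      by (intro exI[of _ "(U', snd p \<union> W)"]) auto
  qed
  then obtain f where f: "\<And>n. compact_nhd_one (fst (f n))" "\<And>n. openin T (snd (f n))" "f 0 = (U0, {})"
      "\<And>n. \<exists>V W. Q n (f n) (f (Suc n)) V W" by blast
  obtain V W where Q: "\<And>n. Q n (f n) (f (Suc n)) (V n) (W n)" using f(4) by metis
  define U where "U n = fst (f n)" for n
  define Z where "Z n = snd (f n)" for n
  have U: "compact_nhd_one (U n)" for n using f(1) by (simp add: U_def)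
  have U_0: "U 0 = U0" and Z_0: "Z 0 = {}" using f(3) by (auto simp: U_def Z_def)
  have Z_Suc: "Z (Suc n) = Z n \<union> W n" and V: "openin T (V n)" "\<one> \<in> V n" and W: "openin T (W n)"
    and density: "measure \<mu> (K - Z n - W n) \<le> (1 - 1 / (16 * real (Suc n))) * measure \<mu> (K - Z n)"
    and avoid: "avoidable K (Suc n) (U n) (U (Suc n)) (V n) (W n)" for n
    using Q[of n] unfolding Q_def U_def Z_def by blast+
  have Z_eq: "Z n = (\<Union>i<n. W i)" for n
    by (induction n) (auto simp: Z_0 Z_Suc lessThan_Suc)
  define C where "C = K - (\<Union>n. W n)"
  have C: "compactin T C"
  proof -
    have "closedin T (topspace T - (\<Union>n. W n))" using W by (intro closedin_diff) auto
    from closed_Int_compactin[OF this K] have "compactin T ((topspace T - (\<Union>n. W n)) \<inter> K)" .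
    moreover have "(topspace T - (\<Union>n. W n)) \<inter> K = C"
      using compactin_subset_topspace[OF K] unfolding C_def by blast
    ultimately show ?thesis by simp
  qed
  have Kf: "K \<in> fmeasurable \<mu>" using fmeasurable_compactin[OF K] .
  have KZ: "measure \<mu> (K - Z n) \<le> (\<Prod>i<n. 1 - 1 / (16 * real (Suc i))) * measure \<mu> K" for n
  proof (induction n)
    case 0
    show ?case by (simp add: Z_0)
  next
    case (Suc n)
    have "measure \<mu> (K - Z (Suc n)) \<le> (1 - 1 / (16 * real (Suc n))) * measure \<mu> (K - Z n)"
      using density[of n] by (simp add: Z_Suc Diff_eq Int_assoc)
    also have "\<dots> \<le> (1 - 1 / (16 * real (Suc n))) * ((\<Prod>i<n. 1 - 1 / (16 * real (Suc i))) * measure \<mu> K)"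
      using Suc by (intro mult_left_mono) (auto simp: field_simps)
    finally show ?case by (simp add: mult_ac)
  qed
  have "measure \<mu> C \<le> (\<Prod>i<n. 1 - 1 / (16 * real (Suc i))) * measure \<mu> K" for n
  proof -
    have "openin T (Z n)" unfolding Z_eq using W by blast
    then have "measure \<mu> C \<le> measure \<mu> (K - Z n)"
      using Kf sets_openin sets_compactin[OF C]
      by (intro measure_mono_fmeasurable fmeasurable_Diff) (auto simp: C_def Z_eq)
    then show ?thesis using KZ[of n] by linarith
  qed
  moreover have "(\<lambda>n. (\<Prod>i<n. 1 - 1 / (16 * real (Suc i))) * measure \<mu> K) \<longlonglongrightarrow> 0 * measure \<mu> K"
    by (intro tendsto_mult tendsto_const prod_one_minus_inverse_tendsto_0)
  ultimately have "measure \<mu> C \<le> 0 * measure \<mu> K" using LIMSEQ_le_const by blast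
  then have "measure \<mu> C = 0" using measure_nonneg[of \<mu> C] by simp
  then have C_null: "emeasure \<mu> C = 0"
    using fmeasurable_compactin[OF C] by (simp add: emeasure_eq_measure2)
  have catch: "\<exists>a\<in>carrier G. \<forall>x\<in>L. (\<forall>n. x \<in> S n <#> V n) \<longrightarrow> a \<otimes> x \<in> C"
    if "\<forall>n. finite (S n) \<and> card (S n) \<le> Suc n \<and> S n \<subseteq> L" for S :: "nat \<Rightarrow> 'a set"
  proof -
    note S = that[rule_format]
    define R where "R n a a' \<longleftrightarrow> a' <# U (Suc n) \<subseteq> a <# U n \<and>
        (\<forall>s\<in>S n. \<forall>u\<in>U (Suc n). \<forall>v\<in>V n. a' \<otimes> u \<otimes> (s \<otimes> v) \<notin> W n)" for n a a'
    have "\<exists>a. \<forall>n. (a n \<in> carrier G \<and> a n <# U n \<subseteq> U0) \<and> R n (a n) (a (Suc n))"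
    proof (rule dependent_nat_choice)
      have "\<one> <# U 0 \<subseteq> U0" using U0c by (auto simp: U_0 l_coset_def)
      then show "\<exists>a. a \<in> carrier G \<and> a <# U 0 \<subseteq> U0" by blast
      fix y n assume y: "y \<in> carrier G \<and> y <# U n \<subseteq> U0"
      have "y \<in> U0"
      proof -
        have "y \<otimes> \<one> \<in> y <# U n" using one_in_compact_nhd[OF U[of n]] unfolding l_coset_def by blast
        then show ?thesis using y by auto
      qed
      then have "\<forall>s\<in>S n. y \<otimes> s \<in> K" using S[of n] unfolding K_def set_mult_def by blast
      then have "finite (S n) \<and> card (S n) \<le> Suc n \<and> S n \<subseteq> carrier G \<and> (\<forall>s\<in>S n. y \<otimes> s \<in> K)"
        using S[of n] Lc by blast
      from bspec[OF avoid[of n, unfolded avoidable_def] conjunct1[OF y], THEN spec, THEN mp, OF this]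
      obtain a where a: "a \<in> carrier G" "R n y a" unfolding R_def by blast
      then have "a <# U (Suc n) \<subseteq> y <# U n" by (simp add: R_def)
      then have "a <# U (Suc n) \<subseteq> U0" using y by (rule subset_trans[OF _ conjunct2])
      with a show "\<exists>a. (a \<in> carrier G \<and> a <# U (Suc n) \<subseteq> U0) \<and> R n y a" by blast
    qed
    then obtain a where a: "\<And>n. a n \<in> carrier G" "\<And>n. a n <# U n \<subseteq> U0" "\<And>n. R n (a n) (a (Suc n))"
      by blast
    define X where "X n = a n <# U n" for n
    have X: "compactin T (X n)" for n
      unfolding X_def using U a(1) by (intro compactin_l_coset) (auto simp: compact_nhd_one_def)
    \<comment> \<open>A common point \<open>b\<close> is \<open>a (Suc n) \<otimes> u\<close> with
      \<open>u\<close> in \<open>U (Suc n)\<close>, so the avoidance secured at stage n applies to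
      \<open>b\<close> itself.\<close>
    have "(\<Inter>n. X n) \<noteq> {}"
    proof (rule compact_space_imp_nest)
      show "compact_space (subtopology T U0)" using U0comp by (rule compact_space_subtopology)
      show "closedin (subtopology T U0) (X n)" for n
        using compactin_imp_closedin[OF Hausdorff X] a(2)[of n]
        by (intro closedin_subset_topspace) (auto simp: X_def)
      show "X n \<noteq> {}" for n using one_in_compact_nhd[OF U[of n]] by (auto simp: X_def l_coset_def)
      show "decseq X" using a(3) by (intro decseq_SucI) (auto simp: X_def R_def)
    qed
    then obtain b where b: "\<And>n. b \<in> X n" by blast
    have "b \<in> U0" using b[of 0] a(2)[of 0] by (auto simp: X_def)
    have "b \<otimes> x \<in> C" if x: "x \<in> L" "\<And>n. x \<in> S n <#> V n" for x
    proof -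
      have "b \<otimes> x \<in> K" using \<open>b \<in> U0\<close> x(1) unfolding K_def set_mult_def by blast
      moreover have "b \<otimes> x \<notin> W n" for n
      proof -
        obtain s v where sv: "s \<in> S n" "v \<in> V n" "x = s \<otimes> v" using x(2)[of n] by (auto simp: set_mult_def)
        obtain u where u: "u \<in> U (Suc n)" "b = a (Suc n) \<otimes> u" using b[of "Suc n"] by (auto simp: X_def l_coset_def)
        show ?thesis using a(3)[of n] sv u unfolding R_def by blast
      qed
      ultimately show ?thesis by (simp add: C_def)
    qed
    then show ?thesis using \<open>b \<in> U0\<close> U0c by blast
  qed
  show thesis by (rule that[OF C C_null V catch])
qed

section \<open>Covering the group by translates\<close>

text \<open>A point of \<open>L\<close> is coded by a function on the naturals that picks, for each
  n, a member of a finite cover by translates of \<open>V n\<close>. A slalom capturing the code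
  thereby captures the point, and the countable \<open>D\<close> is absorbed by the infinite
  \<open>cof_null\<close>.\<close>

lemma nice_groupI:
  assumes "topological_group G T" "comm_group G" "locally_compact_space T"
    and nd: "T \<noteq> discrete_topology (carrier G)"
    and L: "compactin T L" "L \<noteq> {}"
    and D: "countable D" "D \<subseteq> carrier G" "carrier G = D <#>\<^bsub>G\<^esub> L"
  shows "nice_group G T"
proof -
  interpret topological_group G T by fact
  interpret comm_group G by fact
  have lcg: "locally_compact_group G T"
    using assms(3) by unfold_locales
  obtain \<H> where \<H>: "cofinal_null_family \<H>" "cof_null = |\<H>|" using cof_null_is_minimum(1) by blast
  have inf: "infinite \<H>" using cofinal_null_family_infinite[OF \<H>(1)] .
  have D_le: "|D| \<le>o |\<H>|"
    using D(1) inf by (metis card_of_ordLeq countable_def infinite_iff_card_of_nat ordLeq_transitive subset_UNIV)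
  have Lc: "L \<subseteq> carrier G" using compactin_subset_carrier[OF L(1)] .
  show ?thesis
  proof (cases "\<exists>\<mu>. left_haar_measure G T \<mu>")
    \<comment> \<open>Without a Haar measure every set is \<open>haar_null\<close>, and
      \<open>L\<close> itself can be translated by \<open>D\<close>.\<close>
    case False
    then have "haar_null G T L" by (simp add: haar_null_def)
    moreover have "carrier G = (\<Union>a\<in>D. a <#\<^bsub>G\<^esub> L)"
      using D(3) by (auto simp: set_mult_def l_coset_def)
    ultimately show ?thesis
      unfolding nice_group_def using lcg L(1) D(2) D_le \<H>(2) by auto
  next
    case True
    then obtain \<mu> where \<mu>: "left_haar_measure G T \<mu>" by blast
    interpret abelian_haar_group G T \<mu>
      using assms(3) \<mu> by unfold_locales
    obtain C V where C: "compactin T C" "emeasure \<mu> C = 0" and V: "\<And>n. openin T (V n)" "\<And>n. \<one>\<^bsub>G\<^esub> \<in> V n"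
      and catch: "\<And>S :: nat \<Rightarrow> 'a set. \<forall>n. finite (S n) \<and> card (S n) \<le> Suc n \<and> S n \<subseteq> L \<Longrightarrow>
         \<exists>a\<in>carrier G. \<forall>x\<in>L. (\<forall>n. x \<in> S n <#>\<^bsub>G\<^esub> V n) \<longrightarrow> a \<otimes>\<^bsub>G\<^esub> x \<in> C"
      by (rule exists_compact_null_set_catching_slaloms[OF nd L(1)]) (rule that)
    have "haar_null G T C"
      unfolding haar_null_def using null_for_other_haar_measure C by blast
    have "\<exists>F. finite F \<and> F \<subseteq> L \<and> L \<subseteq> (\<Union>f\<in>F. f <#\<^bsub>G\<^esub> V n)" for n
      using compactin_cover_l_cosets[OF L(1) V] by metis
    then obtain F where F: "\<And>n. finite (F n)" "\<And>n. F n \<subseteq> L" "\<And>n. L \<subseteq> (\<Union>f\<in>F n. f <#\<^bsub>G\<^esub> V n)"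
      by metis
    have F_ne: "F n \<noteq> {}" for n using F(3)[of n] L(2) by auto
    \<comment> \<open>\<open>from_nat_into\<close> is total and stays inside the nonempty
      \<open>F n\<close>, repeating values; so every slalom of naturals maps to a slalom in
      \<open>L\<close> of no greater width.\<close>
    define e where "e n = from_nat_into (F n)" for n
    have e: "e n k \<in> F n" for n k unfolding e_def using from_nat_into[OF F_ne] .
    obtain \<S> :: "(nat \<Rightarrow> nat set) set" where \<S>: "|\<S>| \<le>o |\<H>|"
        "\<And>S n. S \<in> \<S> \<Longrightarrow> finite (S n) \<and> card (S n) \<le> Suc n" "\<And>f. \<exists>S\<in>\<S>. \<forall>n. f n \<in> S n"
      by (rule slalom_family[OF \<H>(1)]) (rule that)
    have "\<exists>a\<in>carrier G. \<forall>x\<in>L. (\<forall>n. x \<in> (e n ` S n) <#>\<^bsub>G\<^esub> V n) \<longrightarrow> a \<otimes>\<^bsub>G\<^esub> x \<in> C" if "S \<in> \<S>" for S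
    proof (intro catch allI)
      fix n
      have "finite (S n)" "card (S n) \<le> Suc n" using \<S>(2)[OF that] by auto
      then show "finite (e n ` S n) \<and> card (e n ` S n) \<le> Suc n \<and> e n ` S n \<subseteq> L"
        using card_image_le[of "S n" "e n"] e F(2) by (auto intro: order_trans)
    qed
    then obtain a where a: "\<And>S. S \<in> \<S> \<Longrightarrow> a S \<in> carrier G"
        "\<And>S x. S \<in> \<S> \<Longrightarrow> x \<in> L \<Longrightarrow> (\<And>n. x \<in> (e n ` S n) <#>\<^bsub>G\<^esub> V n) \<Longrightarrow> a S \<otimes>\<^bsub>G\<^esub> x \<in> C"
      by metis
    \<comment> \<open>For \<open>g = d \<otimes> x\<close> with \<open>x\<close> captured by
      \<open>S\<close>, the product \<open>a S \<otimes> x\<close> lies in \<open>C\<close>; undoing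
      \<open>a S\<close> gives the translating element.\<close>
    define A where "A = (\<lambda>(d, S). d \<otimes>\<^bsub>G\<^esub> inv\<^bsub>G\<^esub> (a S)) ` (D \<times> \<S>)"
    have A_sub: "A \<subseteq> carrier G" using a(1) D(2) by (auto simp: A_def)
    have "|A| \<le>o |D \<times> \<S>|" unfolding A_def by (rule card_of_image)
    also have "|D \<times> \<S>| \<le>o |\<H>|"
      by (intro card_of_Sigma_ordLeq_infinite ballI inf D_le \<S>(1))
    finally have A_le: "|A| \<le>o cof_null" using \<H>(2) by simp
    have "carrier G = (\<Union>a\<in>A. a <#\<^bsub>G\<^esub> C)"
    proof
      show "(\<Union>a\<in>A. a <#\<^bsub>G\<^esub> C) \<subseteq> carrier G"
        using A_sub l_coset_subset_carrier compactin_subset_carrier[OF C(1)] by blast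
      show "carrier G \<subseteq> (\<Union>a\<in>A. a <#\<^bsub>G\<^esub> C)"
      proof
        fix g assume "g \<in> carrier G"
        then obtain d x where dx: "d \<in> D" "x \<in> L" "g = d \<otimes>\<^bsub>G\<^esub> x" using D(3) by (auto simp: set_mult_def)
        have "\<exists>k. x \<in> e n k <#\<^bsub>G\<^esub> V n" for n
        proof -
          obtain y where y: "y \<in> F n" "x \<in> y <#\<^bsub>G\<^esub> V n" using F(3)[of n] dx(2) by blast
          obtain k where "e n k = y"
            using from_nat_into_surj[OF countable_finite[OF F(1)] y(1)] unfolding e_def by blast
          then show ?thesis using y(2) by blast
        qed
        then obtain k where k: "\<And>n. x \<in> e n (k n) <#\<^bsub>G\<^esub> V n" by metis
        obtain S where S: "S \<in> \<S>" "\<And>n. k n \<in> S n" using \<S>(3)[of k] by blast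
        have "a S \<otimes>\<^bsub>G\<^esub> x \<in> C"
        proof (rule a(2)[OF S(1) dx(2)])
          show "x \<in> (e n ` S n) <#>\<^bsub>G\<^esub> V n" for n
            using k[of n] S(2)[of n] unfolding l_coset_def set_mult_def by blast
        qed
        moreover have "g = (d \<otimes>\<^bsub>G\<^esub> inv\<^bsub>G\<^esub> (a S)) \<otimes>\<^bsub>G\<^esub> (a S \<otimes>\<^bsub>G\<^esub> x)"
        proof -
          have c: "d \<in> carrier G" "x \<in> carrier G" "a S \<in> carrier G"
            using dx D(2) Lc a(1)[OF S(1)] by auto
          have "(d \<otimes>\<^bsub>G\<^esub> inv\<^bsub>G\<^esub> (a S)) \<otimes>\<^bsub>G\<^esub> (a S \<otimes>\<^bsub>G\<^esub> x) = d \<otimes>\<^bsub>G\<^esub> ((inv\<^bsub>G\<^esub> (a S) \<otimes>\<^bsub>G\<^esub> a S) \<otimes>\<^bsub>G\<^esub> x)"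
            using c by (simp only: m_assoc inv_closed m_closed)
          then show ?thesis using c dx(3) by simp
        qed
        moreover have "d \<otimes>\<^bsub>G\<^esub> inv\<^bsub>G\<^esub> (a S) \<in> A" using dx(1) S(1) by (auto simp: A_def)
        ultimately show "g \<in> (\<Union>a\<in>A. a <#\<^bsub>G\<^esub> C)" unfolding l_coset_def by blast
      qed
    qed
    then show ?thesis
      unfolding nice_group_def using lcg C(1) \<open>haar_null G T C\<close> A_sub A_le by blast
  qed
qed

theorem corollary2p6:
  fixes G :: "('a, 'b) monoid_scheme" and T :: "'a topology"
  assumes "topological_group G T" and "comm_group G"
  shows "(compact_space T \<and> uncountable (carrier G) \<longrightarrow> nice_group G T) \<and>
         (locally_compact_space T \<and> separable_space T \<and> T \<noteq> discrete_topology (carrier G)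
            \<longrightarrow> nice_group G T)"
proof (intro conjI impI)
  interpret topological_group G T by fact
  show "nice_group G T" if asm: "compact_space T \<and> uncountable (carrier G)"
  proof (rule nice_groupI[OF assms])
    show "locally_compact_space T" using asm compact_imp_locally_compact_space by blast
    show "T \<noteq> discrete_topology (carrier G)"
      using asm by (metis compact_space_discrete_topology uncountable_infinite)
    show "compactin T (carrier G)" using asm topspace_eq by (metis compact_space_def)
    show "carrier G = {\<one>\<^bsub>G\<^esub>} <#>\<^bsub>G\<^esub> carrier G" by (auto simp: set_mult_def)
  qed auto
  show "nice_group G T"
    if asm: "locally_compact_space T \<and> separable_space T \<and> T \<noteq> discrete_topology (carrier G)"
  proof -
    have "openin T (carrier G)" using topspace_eq openin_topspace by metis
    then obtain L where L: "compact_nhd_one L"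
      using exists_compact_nhd_one[OF _ _ one_closed] asm by metis
    then obtain N where N: "openin T N" "\<one>\<^bsub>G\<^esub> \<in> N" "N \<subseteq> L" by (auto simp: compact_nhd_one_def)
    \<comment> \<open>Density puts some \<open>d = g \<otimes> s\<close> of \<open>D\<close> into
      \<open>g <# S\<close>; symmetry turns this into \<open>g = d \<otimes> inv s\<close> with
      \<open>inv s\<close> in \<open>L\<close>.\<close>
    obtain S where S: "openin T S" "\<one>\<^bsub>G\<^esub> \<in> S" "S \<subseteq> N" "\<And>x. x \<in> S \<Longrightarrow> inv\<^bsub>G\<^esub> x \<in> S"
      by (rule symmetric_nhd_one[OF N(1,2)]) (rule that)
    obtain D where D: "countable D" "D \<subseteq> topspace T" "T closure_of D = topspace T"
      using asm unfolding separable_space_def by blast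
    show ?thesis
    proof (rule nice_groupI[OF assms])
      show "compactin T L" "L \<noteq> {}" using L by (auto simp: compact_nhd_one_def)
      show "D \<subseteq> carrier G" using D(2) topspace_eq by simp
      have Lc: "L \<subseteq> carrier G" using L by (rule compact_nhd_one_subset_carrier)
      show "carrier G = D <#>\<^bsub>G\<^esub> L"
      proof
        show "D <#>\<^bsub>G\<^esub> L \<subseteq> carrier G" using D(2) topspace_eq Lc by (intro set_mult_closed) auto
        show "carrier G \<subseteq> D <#>\<^bsub>G\<^esub> L"
        proof
          fix g assume g: "g \<in> carrier G"
          have "g \<otimes>\<^bsub>G\<^esub> \<one>\<^bsub>G\<^esub> \<in> g <#\<^bsub>G\<^esub> S" using S(2) unfolding l_coset_def by blast
          moreover have "openin T (g <#\<^bsub>G\<^esub> S)" using S(1) g by (rule openin_l_coset)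
          moreover have "g \<in> T closure_of D" using D(3) g topspace_eq by simp
          ultimately obtain d where d: "d \<in> D" "d \<in> g <#\<^bsub>G\<^esub> S"
            unfolding in_closure_of using g by auto
          then obtain s where s: "s \<in> S" "d = g \<otimes>\<^bsub>G\<^esub> s" by (auto simp: l_coset_def)
          have sc: "s \<in> carrier G" using s(1) openin_subset_carrier[OF S(1)] by blast
          have "g = d \<otimes>\<^bsub>G\<^esub> inv\<^bsub>G\<^esub> s" using s(2) g sc by (simp add: m_assoc)
          moreover have "inv\<^bsub>G\<^esub> s \<in> L" using S(3,4) s(1) N(3) by blast
          ultimately show "g \<in> D <#>\<^bsub>G\<^esub> L" using d(1) unfolding set_mult_def by blast
        qed
      qed
    qed (use asm D(1) in auto)
  qed
qed

end
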